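(* Let $H:\ell^2(\mathbb{Z}^d)\to\ell^2(\mathbb{Z}^d)$ be a bounded self-adjoint Schrödinger operator, and let $\mu$ be a locally finite Borel measure on $\mathbb{R}$. Assume that there exists a sequence of periodic bounded self-adjoint Schrödinger operators $H_n:\ell^2(\mathbb{Z}^d)\to\ell^2(\mathbb{Z}^d)$ such that $$\delta_n:=d_H\big(\operatorname{spec}(H_n),\operatorname{spec}(H)\big)\to 0\quad\text{as } n\to\infty.$$ For each $n$, write $\operatorname{spec}(H_n)=\bigcup_{i=1}^{q_n}[a_i^{(n)},b_i^{(n)}]$, where $[a_i^{(n)},b_i^{(n)}]$ is the $i$-th spectral band of $H_n$ (the range of the $i$-th eigenvalue of the Bloch–Floquet matrices $H_n(\theta)$, $\theta\in[0,1)^d$). Then $$\mu\big(\operatorname{spec}(H)\big)=\lim_{n\to\infty}\mu\Big(\bigcup_{i=1}^{q_n}\big[a_i^{(n)}-\delta_n,\ b_i^{(n)}+\delta_n\big]\Big).$$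
   Context: A discrete Schrödinger operator on $\ell^2(\mathbb{Z}^d)$ is an operator $[H\psi](\mathsf{n})=\sum_{\|\mathsf{m}-\mathsf{n}\|=1}\psi(\mathsf{m})+V(\mathsf{n})\psi(\mathsf{n})$, $\mathsf{n}\in\mathbb{Z}^d$, with potential $V:\mathbb{Z}^d\to\mathbb{R}$ and $\|\cdot\|$ the 1-norm. It is periodic with periods $p_1,\dots,p_d\in\mathbb{N}$ (positive integers) if $V(\mathsf{n}+p_j\mathsf{e}_j)=V(\mathsf{n})$ for all $\mathsf{n}\in\mathbb{Z}^d$ and $1\le j\le d$, where $\mathsf{e}_j$ are the standard basis vectors. Bloch–Floquet matrices: for a periodic $H$ with periods $p_1,\dots,p_d$, put $Q=\prod_{j=1}^d\{0,\dots,p_j-1\}$ and $q=\prod_{j=1}^d p_j$. For $\theta\in[0,1)^d$, the formula for $H$ acts on the $q$-dimensional space of functions $\psi:\mathbb{Z}^d\to\mathbb{C}$ with $\psi(\mathsf{n}+p_j\mathsf{e}_j)=e^{2\pi i p_j\theta_j}\psi(\mathsf{n})$ for all $\mathsf{n}$ and $j$; identifying such $\psi$ with its values on $Q$, this action is a self-adjoint $q\times q$ matrix $H(\theta)$, with ordered eigenvalues $\lambda_1(\theta)\le\dots\le\lambda_q(\theta)$. By Bloch–Floquet theory each $\lambda_i$ is continuous in $\theta$ and $\operatorname{spec}(H)=\bigcup_{i=1}^q[a_i,b_i]$ with $a_i=\min_{\theta\in[0,1)^d}\lambda_i(\theta)$, $b_i=\max_{\theta\in[0,1)^d}\lambda_i(\theta)$.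 For $H_n$ the corresponding quantities are denoted $q_n$, $a_i^{(n)}$, $b_i^{(n)}$ (with a choice of periods fixed for each $n$). The Hausdorff distance between nonempty $A,B\subseteq\mathbb{R}$ is $d_H(A,B)=\max\{\sup_{a\in A}d(a,B),\sup_{b\in B}d(b,A)\}$, where $d(a,B)=\inf_{b\in B}|a-b|$. A Borel measure is locally finite if every point has a neighborhood of finite measure. *)

theory Defs
  imports
    "HOL-Analysis.Analysis"
    "HOL-Computational_Algebra.Fundamental_Theorem_Algebra"
    "Jordan_Normal_Form.Char_Poly"
begin

text \<open>
  The lattice \<open>\<int>\<^sup>d\<close> is the type \<open>'d \<Rightarrow> int\<close>, where \<open>'d\<close> is a finite index type; the dimension is the
  cardinality of \<open>'d\<close>.
\<close>

section \<open>Operators on square-summable functions\<close>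

definition ell2 :: "('a \<Rightarrow> complex) set" where
  "ell2 = {\<psi>. (\<lambda>n. (cmod (\<psi> n))\<^sup>2) summable_on UNIV}"

definition ell2_inner :: "('a \<Rightarrow> complex) \<Rightarrow> ('a \<Rightarrow> complex) \<Rightarrow> complex" where
  "ell2_inner \<phi> \<psi> = (\<Sum>\<^sub>\<infinity>n. cnj (\<phi> n) * \<psi> n)"

definition ell2_norm :: "('a \<Rightarrow> complex) \<Rightarrow> real" where
  "ell2_norm \<psi> = sqrt (\<Sum>\<^sub>\<infinity>n. (cmod (\<psi> n))\<^sup>2)"

text \<open>An operator on \<open>\<ell>\<^sup>2\<close> is a map on all functions; only its restriction to \<^const>\<open>ell2\<close> matters below.\<close>

definition bounded_op :: "(('a \<Rightarrow> complex) \<Rightarrow> ('a \<Rightarrow> complex)) \<Rightarrow> bool" where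
  "bounded_op T \<longleftrightarrow>
     (\<forall>\<psi>\<in>ell2. T \<psi> \<in> ell2) \<and>
     (\<forall>\<phi>\<in>ell2. \<forall>\<psi>\<in>ell2. T (\<lambda>n. \<phi> n + \<psi> n) = (\<lambda>n. T \<phi> n + T \<psi> n)) \<and>
     (\<forall>c. \<forall>\<psi>\<in>ell2. T (\<lambda>n. c * \<psi> n) = (\<lambda>n. c * T \<psi> n)) \<and>
     (\<exists>C. \<forall>\<psi>\<in>ell2. ell2_norm (T \<psi>) \<le> C * ell2_norm \<psi>)"

definition selfadjoint_op :: "(('a \<Rightarrow> complex) \<Rightarrow> ('a \<Rightarrow> complex)) \<Rightarrow> bool" where
  "selfadjoint_op T \<longleftrightarrow> (\<forall>\<phi>\<in>ell2. \<forall>\<psi>\<in>ell2. ell2_inner (T \<phi>) \<psi> = ell2_inner \<phi> (T \<psi>))"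

definition op_spectrum :: "(('a \<Rightarrow> complex) \<Rightarrow> ('a \<Rightarrow> complex)) \<Rightarrow> complex set" where
  "op_spectrum T = {z. \<not> (\<exists>S. bounded_op S \<and>
     (\<forall>\<psi>\<in>ell2. S (\<lambda>n. T \<psi> n - z * \<psi> n) = \<psi>) \<and>
     (\<forall>\<psi>\<in>ell2. (\<lambda>n. T (S \<psi>) n - z * S \<psi> n) = \<psi>))}"

text \<open>
  The spectrum as a set of reals. For self-adjoint operators nothing is lost, their spectrum being
  contained in the real axis.
\<close>

definition spec :: "(('a \<Rightarrow> complex) \<Rightarrow> ('a \<Rightarrow> complex)) \<Rightarrow> real set" where
  "spec T = {x. complex_of_real x \<in> op_spectrum T}"

section \<open>Discrete Schroedinger operators\<close>

definition dist1 :: "('d::finite \<Rightarrow> int) \<Rightarrow> ('d \<Rightarrow> int) \<Rightarrow> int" where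
  "dist1 m n = (\<Sum>j\<in>UNIV. \<bar>m j - n j\<bar>)"

lemma finite_neighbours: "finite {m. dist1 m (n :: 'd::finite \<Rightarrow> int) = 1}"
proof (rule finite_subset)
  show "{m. dist1 m n = 1} \<subseteq> (\<Pi>\<^sub>E j\<in>UNIV. {n j - 1..n j + 1})"
  proof
    fix m assume "m \<in> {m. dist1 m n = 1}"
    then have s: "(\<Sum>j\<in>UNIV. \<bar>m j - n j\<bar>) = 1"
      by (simp add: dist1_def)
    have "\<bar>m j - n j\<bar> \<le> 1" for j
      unfolding s[symmetric] by (rule member_le_sum) auto
    then have "m j \<in> {n j - 1..n j + 1}" for j
      by (smt (verit) atLeastAtMost_iff)
    then show "m \<in> (\<Pi>\<^sub>E j\<in>UNIV. {n j - 1..n j + 1})"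
      by auto
  qed
qed (auto intro: finite_PiE)

definition schrodinger ::
  "(('d::finite \<Rightarrow> int) \<Rightarrow> real) \<Rightarrow> (('d \<Rightarrow> int) \<Rightarrow> complex) \<Rightarrow> (('d \<Rightarrow> int) \<Rightarrow> complex)" where
  "schrodinger V \<psi> n = (\<Sum>m | dist1 m n = 1. \<psi> m) + complex_of_real (V n) * \<psi> n"

text \<open>The update \<open>n(j := n j + int (p j))\<close> is \<open>n + p\<^sub>j e\<^sub>j\<close>.\<close>

definition periodic_potential :: "('d::finite \<Rightarrow> nat) \<Rightarrow> (('d \<Rightarrow> int) \<Rightarrow> real) \<Rightarrow> bool" where
  "periodic_potential p V \<longleftrightarrow>
     (\<forall>j. 0 < p j) \<and> (\<forall>n j. V (n(j := n j + int (p j))) = V n)"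

section \<open>Bloch--Floquet matrices and spectral bands\<close>

definition cell :: "('d::finite \<Rightarrow> nat) \<Rightarrow> ('d \<Rightarrow> int) set" where
  "cell p = {n. \<forall>j. 0 \<le> n j \<and> n j < int (p j)}"

definition cell_size :: "('d::finite \<Rightarrow> nat) \<Rightarrow> nat" where
  "cell_size p = (\<Prod>j\<in>UNIV. p j)"

text \<open>An enumeration of the cell; the choice affects the matrices below only by a permutation.\<close>

definition cell_enum :: "('d::finite \<Rightarrow> nat) \<Rightarrow> nat \<Rightarrow> ('d \<Rightarrow> int)" where
  "cell_enum p = (SOME e. bij_betw e {..<cell_size p} (cell p))"

definition floquet_space ::
  "('d::finite \<Rightarrow> nat) \<Rightarrow> ('d \<Rightarrow> real) \<Rightarrow> (('d \<Rightarrow> int) \<Rightarrow> complex) set" where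
  "floquet_space p \<theta> =
     {\<psi>. \<forall>n j. \<psi> (n(j := n j + int (p j))) = cis (2 * pi * real (p j) * \<theta> j) * \<psi> n}"

text \<open>
  The element of the Floquet space with prescribed values on the cell; see \<open>floquet_ext_unique\<close>.
\<close>

definition floquet_ext ::
  "('d::finite \<Rightarrow> nat) \<Rightarrow> ('d \<Rightarrow> real) \<Rightarrow> (('d \<Rightarrow> int) \<Rightarrow> complex) \<Rightarrow> (('d \<Rightarrow> int) \<Rightarrow> complex)" where
  "floquet_ext p \<theta> u n =
     cis (2 * pi * (\<Sum>j\<in>UNIV. real (p j) * \<theta> j * real_of_int (n j div int (p j)))) *
     u (\<lambda>j. n j mod int (p j))"

text \<open>
  The matrix of the action of the Schroedinger formula on the Floquet space, whose elements are
  identified with their values on the cell; see \<open>floquet_matrix_action\<close>.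
\<close>

definition floquet_matrix ::
  "('d::finite \<Rightarrow> nat) \<Rightarrow> (('d \<Rightarrow> int) \<Rightarrow> real) \<Rightarrow> ('d \<Rightarrow> real) \<Rightarrow> complex mat" where
  "floquet_matrix p V \<theta> = mat (cell_size p) (cell_size p)
     (\<lambda>(r, s). schrodinger V (floquet_ext p \<theta> (\<lambda>m. if m = cell_enum p s then 1 else 0)) (cell_enum p r))"

text \<open>
  The eigenvalues, counted with multiplicity and in increasing order; the index starts at 0. They
  are real because the matrix is Hermitian, so taking real parts changes nothing.
\<close>

definition floquet_eigenvalue ::
  "('d::finite \<Rightarrow> nat) \<Rightarrow> (('d \<Rightarrow> int) \<Rightarrow> real) \<Rightarrow> nat \<Rightarrow> ('d \<Rightarrow> real) \<Rightarrow> real" where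
  "floquet_eigenvalue p V i \<theta> =
     sorted_list_of_multiset (image_mset Re (proots (char_poly (floquet_matrix p V \<theta>)))) ! i"

definition quasimomenta :: "('d::finite \<Rightarrow> real) set" where
  "quasimomenta = {\<theta>. \<forall>j. 0 \<le> \<theta> j \<and> \<theta> j < 1}"

text \<open>
  The endpoints of the bands. The extrema are attained, the eigenvalues being continuous and
  1-periodic in each quasimomentum.
\<close>

definition band_lower :: "('d::finite \<Rightarrow> nat) \<Rightarrow> (('d \<Rightarrow> int) \<Rightarrow> real) \<Rightarrow> nat \<Rightarrow> real" where
  "band_lower p V i = (INF \<theta>\<in>quasimomenta. floquet_eigenvalue p V i \<theta>)"

definition band_upper :: "('d::finite \<Rightarrow> nat) \<Rightarrow> (('d \<Rightarrow> int) \<Rightarrow> real) \<Rightarrow> nat \<Rightarrow> real" where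
  "band_upper p V i = (SUP \<theta>\<in>quasimomenta. floquet_eigenvalue p V i \<theta>)"

lemma cell_enum_bij: "bij_betw (cell_enum p) {..<cell_size p} (cell (p :: 'd::finite \<Rightarrow> nat))"
proof -
  have c: "cell p = (\<Pi>\<^sub>E j\<in>UNIV. {0..<int (p j)})"
    by (auto simp: cell_def PiE_def Pi_def)
  have "finite (cell p)" "card (cell p) = cell_size p"
    unfolding c by (auto intro: finite_PiE simp: card_PiE cell_size_def)
  then have "\<exists>e. bij_betw e {..<cell_size p} (cell p)"
    using ex_bij_betw_nat_finite[of "cell p"] by (simp add: lessThan_atLeast0)
  then show ?thesis
    unfolding cell_enum_def by (rule someI_ex)
qed

lemma floquet_ext_in_space:
  assumes p: "\<forall>j. 0 < (p :: 'd::finite \<Rightarrow> nat) j"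
  shows "floquet_ext p \<theta> u \<in> floquet_space p \<theta>"
proof -
  have "floquet_ext p \<theta> u (n(j := n j + int (p j))) =
      cis (2 * pi * real (p j) * \<theta> j) * floquet_ext p \<theta> u n" for n j
  proof -
    let ?n = "n(j := n j + int (p j))"
    have pj: "int (p j) \<noteq> 0" using p by (metis less_irrefl of_nat_0_eq_iff)
    have m: "(\<lambda>i. ?n i mod int (p i)) = (\<lambda>i. n i mod int (p i))"
      by auto
    have "(\<Sum>i\<in>UNIV. real (p i) * \<theta> i * real_of_int (?n i div int (p i))) =
        (\<Sum>i\<in>UNIV. real (p i) * \<theta> i * real_of_int (n i div int (p i)) +
           (if i = j then real (p j) * \<theta> j else 0))"
      using pj by (intro sum.cong) (auto simp: algebra_simps)
    also have "\<dots> = (\<Sum>i\<in>UNIV. real (p i) * \<theta> i * real_of_int (n i div int (p i))) + real (p j) * \<theta> j"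
      by (simp add: sum.distrib)
    finally show ?thesis
      unfolding floquet_ext_def m by (simp add: cis_mult algebra_simps)
  qed
  then show ?thesis
    by (simp add: floquet_space_def)
qed

lemma floquet_ext_on_cell: "n \<in> cell p \<Longrightarrow> floquet_ext p \<theta> u n = u n"
  by (simp add: cell_def floquet_ext_def)

lemma floquet_space_shift:
  assumes "\<psi> \<in> floquet_space p \<theta>"
  shows "\<psi> (n(j := n j + k * int (p j))) = cis (2 * pi * real (p j) * \<theta> j * real_of_int k) * \<psi> n"
proof -
  define c where "c = 2 * pi * real (p j) * \<theta> j"
  have step: "\<psi> (n(j := n j + (i + 1) * int (p j))) = cis c * \<psi> (n(j := n j + i * int (p j)))" for i
  proof -
    let ?m = "n(j := n j + i * int (p j))"
    have "\<psi> (?m(j := ?m j + int (p j))) = cis c * \<psi> ?m"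
      using assms unfolding floquet_space_def c_def by blast
    then show ?thesis
      by (simp add: algebra_simps)
  qed
  have "\<psi> (n(j := n j + k * int (p j))) = cis (c * real_of_int k) * \<psi> n"
  proof (induction k rule: int_induct[where k = 0])
    case base
    then show ?case by simp
  next
    case (step1 i)
    have "cis c * cis (c * real_of_int i) = cis (c * real_of_int (i + 1))"
      by (simp add: cis_mult algebra_simps)
    then show ?case
      unfolding step step1 by (metis mult.assoc)
  next
    case (step2 i)
    have "cis c * \<psi> (n(j := n j + (i - 1) * int (p j))) = cis (c * real_of_int i) * \<psi> n"
      using step[of "i - 1"] step2 by simp
    also have "cis (c * real_of_int i) = cis c * cis (c * real_of_int (i - 1))"
      by (simp add: cis_mult algebra_simps)
    finally show ?case
      by simp
  qed
  then show ?thesis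
    by (simp add: c_def)
qed

lemma floquet_space_eq_ext:
  assumes \<psi>: "\<psi> \<in> floquet_space p (\<theta> :: 'd::finite \<Rightarrow> real)"
  shows "floquet_ext p \<theta> \<psi> = \<psi>"
proof
  fix n
  let ?r = "\<lambda>J j. if j \<in> J then n j mod int (p j) else n j"
  have "\<psi> n = cis (2 * pi * (\<Sum>j\<in>J. real (p j) * \<theta> j * real_of_int (n j div int (p j)))) * \<psi> (?r J)"
    if "finite J" for J
    using that
  proof (induction J)
    case empty
    then show ?case by simp
  next
    case (insert j J)
    have "?r J = (?r (insert j J))(j := ?r (insert j J) j + (n j div int (p j)) * int (p j))"
      using insert.hyps by (auto simp: fun_eq_iff)
    then have "\<psi> (?r J) =
        cis (2 * pi * real (p j) * \<theta> j * real_of_int (n j div int (p j))) * \<psi> (?r (insert j J))"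
      using floquet_space_shift[OF \<psi>, of "?r (insert j J)" j "n j div int (p j)"] by simp
    with insert show ?case
      by (simp add: mult.assoc[symmetric] cis_mult distrib_left add.commute)
  qed
  from this[of UNIV] show "floquet_ext p \<theta> \<psi> n = \<psi> n"
    by (simp add: floquet_ext_def)
qed

lemma floquet_ext_cong:
  assumes "\<forall>j. 0 < p j" "\<And>n. n \<in> cell p \<Longrightarrow> u n = v n"
  shows "floquet_ext p \<theta> u = floquet_ext p \<theta> v"
proof
  fix n
  have "(\<lambda>j. n j mod int (p j)) \<in> cell p"
    using assms(1) by (simp add: cell_def)
  then show "floquet_ext p \<theta> u n = floquet_ext p \<theta> v n"
    by (simp add: floquet_ext_def assms(2))
qed

lemma floquet_ext_unique:
  assumes p: "\<forall>j. 0 < (p :: 'd::finite \<Rightarrow> nat) j"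
  shows "(\<psi> \<in> floquet_space p \<theta> \<and> (\<forall>n\<in>cell p. \<psi> n = u n)) \<longleftrightarrow> \<psi> = floquet_ext p \<theta> u"
proof
  assume "\<psi> \<in> floquet_space p \<theta> \<and> (\<forall>n\<in>cell p. \<psi> n = u n)"
  then show "\<psi> = floquet_ext p \<theta> u"
    using floquet_space_eq_ext[of \<psi> p \<theta>] floquet_ext_cong[OF p, of \<psi> u \<theta>] by simp
next
  assume "\<psi> = floquet_ext p \<theta> u"
  then show "\<psi> \<in> floquet_space p \<theta> \<and> (\<forall>n\<in>cell p. \<psi> n = u n)"
    by (simp add: floquet_ext_in_space[OF p] floquet_ext_on_cell)
qed

lemma floquet_matrix_action:
  assumes p: "\<forall>j. 0 < (p :: 'd::finite \<Rightarrow> nat) j"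
    and \<psi>: "\<psi> \<in> floquet_space p \<theta>" and r: "r < cell_size p"
  shows "schrodinger V \<psi> (cell_enum p r) =
    (\<Sum>s<cell_size p. floquet_matrix p V \<theta> $$ (r, s) * \<psi> (cell_enum p s))"
proof -
  let ?b = "\<lambda>s. floquet_ext p \<theta> (\<lambda>m. if m = cell_enum p s then 1 else 0)"
  have 1: "\<psi> n = (\<Sum>s<cell_size p. \<psi> (cell_enum p s) * ?b s n)" for n
  proof -
    let ?m = "\<lambda>j. n j mod int (p j)"
    let ?c = "cis (2 * pi * (\<Sum>j\<in>UNIV. real (p j) * \<theta> j * real_of_int (n j div int (p j))))"
    have m: "?m \<in> cell p"
      using p by (simp add: cell_def)
    have "\<psi> n = ?c * \<psi> ?m"
      using fun_cong[OF floquet_space_eq_ext[OF \<psi>], of n] by (simp add: floquet_ext_def)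
    also have "\<psi> ?m = (\<Sum>m\<in>cell p. \<psi> m * (if ?m = m then 1 else 0))"
    proof -
      have "finite (cell p)"
        using bij_betw_finite[OF cell_enum_bij, of p] by simp
      with m show ?thesis by (simp add: if_distrib cong: if_cong)
    qed
    also have "\<dots> = (\<Sum>s<cell_size p. \<psi> (cell_enum p s) * (if ?m = cell_enum p s then 1 else 0))"
      using sum.reindex_bij_betw[OF cell_enum_bij, of "\<lambda>m. \<psi> m * (if ?m = m then 1 else 0)" p] by simp
    finally show ?thesis
      by (simp add: floquet_ext_def sum_distrib_left mult_ac)
  qed
  have "schrodinger V \<psi> x = (\<Sum>s<cell_size p. \<psi> (cell_enum p s) * schrodinger V (?b s) x)" for x
  proof -
    have "(\<Sum>m | dist1 m x = 1. \<psi> m) =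
        (\<Sum>m | dist1 m x = 1. \<Sum>s<cell_size p. \<psi> (cell_enum p s) * ?b s m)"
      by (intro sum.cong refl 1)
    also have "\<dots> = (\<Sum>s<cell_size p. \<psi> (cell_enum p s) * (\<Sum>m | dist1 m x = 1. ?b s m))"
      by (subst sum.swap) (simp add: sum_distrib_left)
    finally have a: "(\<Sum>m | dist1 m x = 1. \<psi> m) = \<dots>" .
    have "complex_of_real (V x) * \<psi> x =
        (\<Sum>s<cell_size p. \<psi> (cell_enum p s) * (complex_of_real (V x) * ?b s x))"
      by (subst 1) (simp add: sum_distrib_left mult_ac)
    with a show ?thesis
      by (simp add: schrodinger_def distrib_left sum.distrib)
  qed
  with r show ?thesis
    by (simp add: floquet_matrix_def mult.commute)
qed

section \<open>Hausdorff distance and locally finite Borel measures\<close>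

text \<open>
  For nonempty bounded sets, such as the spectra of bounded self-adjoint operators, the suprema
  are taken over nonempty bounded sets of reals.
\<close>

definition hausdorff_distance :: "real set \<Rightarrow> real set \<Rightarrow> real" where
  "hausdorff_distance A B = max (SUP a\<in>A. infdist a B) (SUP b\<in>B. infdist b A)"

definition locally_finite_borel :: "real measure \<Rightarrow> bool" where
  "locally_finite_borel \<mu> \<longleftrightarrow>
     sets \<mu> = sets borel \<and> (\<forall>x. \<exists>U. open U \<and> x \<in> U \<and> emeasure \<mu> U < \<infinity>)"

end

theory Submission
  imports Defs
begin

text \<open>
  For a self-adjoint operator \<open>T\<close>, a real \<open>x\<close> lies outside the spectrum iff \<open>T - x\<close> is bounded below;
  this gives compactness and non-emptiness of the spectrum. For a periodic operator the spectrum is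
  the union of the bands. A Bloch solution \<open>u\<close>, cut off by \<open>exp (- \<epsilon> |n|)\<close>, is an approximate
  eigenvector, so Floquet eigenvalues lie in the spectrum; since they depend continuously on the
  quasimomentum, so do whole bands. Conversely, if \<open>x\<close> is no Floquet eigenvalue, then compactness
  gives a lower bound for \<open>H(\<theta>) - x\<close> that is uniform in \<open>\<theta>\<close>, and it transfers to finitely supported
  functions by Parseval's identity on a large discrete torus. Hence the union of the enlarged bands
  contains the limit spectrum and is contained in its \<open>2 \<delta>\<close>-neighbourhood, and the measures of these
  compact neighbourhoods decrease to that of the spectrum.
\<close>



section \<open>Symmetric operators on real Hilbert spaces\<close>

text \<open>Hausdorff convergence alone does not control measures from below: finite sets can
  converge to an interval. Enlarging each band by \<open>\<delta> n\<close> makes every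
  approximating set contain the limit spectrum, so one inequality holds for each \<open>n\<close>
  and only the other one needs a limit; there local finiteness provides continuity from above. Most
  of the work goes into the band structure of the spectrum. It is derived from lower bounds for
  \<open>T - z\<close> instead of resolvents, because a lower bound can be refuted by one
  approximate eigenvector, tested on finitely supported functions and obtained by compactness.
  Symmetry is what makes such a bound equivalent to invertibility at a real point. The two
  inclusions need opposite cut-offs: a nonzero Bloch solution is bounded but not square-summable and
  has to be damped, whereas a square-summable function has to be truncated before it can be summed
  over the period lattice by finite sums.\<close>

lemma power2_norm_diff:
  fixes x y :: "'a::real_inner"
  shows "(norm (x - y))\<^sup>2 = (norm x)\<^sup>2 - 2 * inner x y + (norm y)\<^sup>2"
  unfolding power2_norm_eq_inner by (simp add: inner_diff_left inner_diff_right inner_commute[of y x])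

text \<open>
  The equation \<open>A (A x) = A y\<close> is solved by iterating \<open>x - (A (A x) - A y) / M\<^sup>2\<close>, a contraction
  because \<open>c\<^sup>2 \<le> A\<^sup>2 \<le> M\<^sup>2\<close>.
\<close>

lemma symmetric_bounded_below_surj:
  fixes A :: "'h::{real_inner,complete_space} \<Rightarrow> 'h"
  assumes A: "bounded_linear A" and sym: "\<And>x y. inner (A x) y = inner x (A y)"
    and c: "c > 0" "\<And>x. c * norm x \<le> norm (A x)"
  shows "surj A"
proof -
  interpret bounded_linear A by fact
  obtain K where K: "K > 0" "\<And>x. norm (A x) \<le> norm x * K"
    using pos_bounded by blast
  \<comment> \<open>Taking \<open>M\<close> at least \<open>c\<close> keeps \<open>k\<close>
    non-negative; \<open>sqrt k\<close> is the contraction constant.\<close>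
  define M where "M = max K c"
  have M: "M > 0" "norm (A x) \<le> M * norm x" for x
    using K(1) K(2)[of x] mult_left_mono[of K M "norm x"] by (auto simp: M_def mult.commute)
  define t where "t = 1 / M\<^sup>2"
  define k where "k = 1 - t * c\<^sup>2"
  have t: "t > 0" "t * M\<^sup>2 = 1" using M by (auto simp: t_def)
  have "c\<^sup>2 \<le> M\<^sup>2" using c(1) by (intro power_mono) (auto simp: M_def)
  then have "t * c\<^sup>2 \<le> 1" using t by (metis less_eq_real_def mult_left_mono)
  then have k: "0 \<le> k" "k < 1" using t c by (auto simp: k_def)
  have contr: "norm (d - t *\<^sub>R A (A d)) \<le> sqrt k * norm d" for d
  proof -
    have "norm (A (A d)) ^ 2 \<le> (M * norm (A d)) ^ 2"
      by (intro power_mono M) auto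
    then have "t\<^sup>2 * (norm (A (A d)))\<^sup>2 \<le> t\<^sup>2 * (M * norm (A d)) ^ 2"
      by (intro mult_left_mono) auto
    also have "\<dots> = t * (t * M\<^sup>2) * (norm (A d))\<^sup>2"
      by (simp add: power2_eq_square)
    finally have 1: "t\<^sup>2 * (norm (A (A d)))\<^sup>2 \<le> t * (norm (A d))\<^sup>2"
      using t by simp
    have "(c * norm d)\<^sup>2 \<le> (norm (A d))\<^sup>2"
      by (intro power_mono c) (use c in auto)
    then have 2: "t * (c\<^sup>2 * (norm d)\<^sup>2) \<le> t * (norm (A d))\<^sup>2"
      using t by (simp add: power_mult_distrib)
    have "(norm (d - t *\<^sub>R A (A d)))\<^sup>2 = (norm d)\<^sup>2 - 2 * t * inner d (A (A d)) + t\<^sup>2 * (norm (A (A d)))\<^sup>2"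
      unfolding power2_norm_diff by (simp add: power_mult_distrib)
    also have "inner d (A (A d)) = (norm (A d))\<^sup>2"
      unfolding power2_norm_eq_inner by (simp add: sym)
    finally have "(norm (d - t *\<^sub>R A (A d)))\<^sup>2 \<le> k * (norm d)\<^sup>2"
      using 1 2 by (simp add: k_def algebra_simps)
    also have "\<dots> = (sqrt k * norm d)\<^sup>2"
      using k by (simp add: power_mult_distrib)
    finally show ?thesis
      using k(1) by (metis power2_le_imp_le mult_nonneg_nonneg norm_ge_zero real_sqrt_ge_zero)
  qed
  show ?thesis
  unfolding surj_def
  proof
    fix y
    define g where "g x = x - t *\<^sub>R (A (A x) - A y)" for x
    have "g x - g x' = (x - x') - t *\<^sub>R A (A (x - x'))" for x x'
      by (simp add: g_def diff algebra_simps)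
    then have "\<forall>x x'. dist (g x) (g x') \<le> sqrt k * dist x x'"
      by (simp add: dist_norm contr)
    then have "\<exists>!x. g x = x"
      using k by (intro banach_fix_type) auto
    then obtain x where "g x = x" by blast
    then have "A (A x - y) = 0" using t by (simp add: g_def diff)
    then have "A x - y = 0" using c(2)[of "A x - y"] c(1)
      by (simp add: mult_le_0_iff)
    then show "\<exists>x. y = A x" by (metis eq_iff_diff_eq_0)
  qed
qed

text \<open>
  With \<open>K = \<parallel>A\<parallel>\<close>, a lower bound for \<open>A\<^sup>2 - K\<^sup>2 = (A - K) (A + K)\<close> would force \<open>\<parallel>A\<parallel> < K\<close>.
\<close>

lemma symmetric_spectrum_nonempty:
  fixes A :: "'h::real_inner \<Rightarrow> 'h"
  assumes A: "bounded_linear A" and sym: "\<And>x y. inner (A x) y = inner x (A y)"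
    and x0: "(x0::'h) \<noteq> 0"
  shows "\<exists>s::real. \<not> (\<exists>c>0. \<forall>x. c * norm x \<le> norm (A x - s *\<^sub>R x))"
proof (rule ccontr)
  assume "\<not> ?thesis"
  then have ex: "\<exists>c>0. \<forall>x. c * norm x \<le> norm (A x - s *\<^sub>R x)" for s by blast
  interpret bounded_linear A by fact
  define K where "K = onorm A"
  have K: "norm (A x) \<le> K * norm x" for x
    unfolding K_def by (rule onorm[OF A])
  have K0: "K \<ge> 0" unfolding K_def by (rule onorm_pos_le[OF A])
  obtain c1 c2 where c1: "c1 > 0" "\<And>x. c1 * norm x \<le> norm (A x - K *\<^sub>R x)"
    and c2: "c2 > 0" "\<And>x. c2 * norm x \<le> norm (A x - (- K) *\<^sub>R x)"
    using ex[of K] ex[of "- K"] by blast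
  define e where "e = (c1 * c2)\<^sup>2"
  have e: "e > 0" using c1 c2 by (simp add: e_def)
  \<comment> \<open>The two lower bounds combine to \<open>c1 * c2 * norm x \<le> norm (A (A x) -
    K\<^sup>2 *\<^sub>R x)\<close>. After squaring, symmetry turns the mixed term into
    \<open>norm (A x)\<close>, and the leading term is absorbed by
    \<open>norm (A (A x)) \<le> K * norm (A x)\<close>.\<close>
  have *: "K\<^sup>2 * (norm (A x))\<^sup>2 + e * (norm x)\<^sup>2 \<le> K\<^sup>2 * (K\<^sup>2 * (norm x)\<^sup>2)" for x
  proof -
    let ?y = "A x - (- K) *\<^sub>R x"
    have "c1 * (c2 * norm x) \<le> c1 * norm ?y" using c1(1) c2(2) by simp
    also have "\<dots> \<le> norm (A ?y - K *\<^sub>R ?y)" by (rule c1)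
    also have "A ?y - K *\<^sub>R ?y = A (A x) - K\<^sup>2 *\<^sub>R x"
      by (simp add: add scaleR power2_eq_square algebra_simps)
    finally have "(c1 * (c2 * norm x))\<^sup>2 \<le> (norm (A (A x) - K\<^sup>2 *\<^sub>R x))\<^sup>2"
      using c1(1) c2(1) by (intro power_mono) auto
    also have "\<dots> = (norm (A (A x)))\<^sup>2 - 2 * K\<^sup>2 * inner x (A (A x)) + (K\<^sup>2)\<^sup>2 * (norm x)\<^sup>2"
      unfolding power2_norm_diff by (simp add: power_mult_distrib inner_commute)
    also have "inner x (A (A x)) = (norm (A x))\<^sup>2"
      unfolding power2_norm_eq_inner by (simp add: sym)
    finally have 1: "e * (norm x)\<^sup>2 \<le> (norm (A (A x)))\<^sup>2 - 2 * K\<^sup>2 * (norm (A x))\<^sup>2 + (K\<^sup>2)\<^sup>2 * (norm x)\<^sup>2"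
      by (simp add: e_def power_mult_distrib algebra_simps)
    have "(norm (A (A x)))\<^sup>2 \<le> (K * norm (A x))\<^sup>2"
      by (intro power_mono K) auto
    with 1 show ?thesis
      by (simp add: power_mult_distrib power2_eq_square[of "K\<^sup>2"] algebra_simps)
  qed
  have n0: "norm x0 > 0" using x0 by simp
  have "K \<noteq> 0"
  proof
    assume "K = 0"
    with *[of x0] e n0 show False by (simp add: mult_le_0_iff)
  qed
  with K0 have Kp: "K > 0" by simp
  \<comment> \<open>Solving the inequality for \<open>norm (A x)\<close> gives \<open>sqrt r\<close>
    as a bound for the operator norm, although \<open>r\<close> is strictly smaller than
    \<open>K\<^sup>2\<close>.\<close>
  define r where "r = K\<^sup>2 - e / K\<^sup>2"
  have r: "(norm (A x))\<^sup>2 \<le> r * (norm x)\<^sup>2" for x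
  proof -
    have "K\<^sup>2 * (norm (A x))\<^sup>2 \<le> K\<^sup>2 * (r * (norm x)\<^sup>2)"
      using *[of x] Kp by (simp add: r_def algebra_simps)
    then show ?thesis using Kp by simp
  qed
  have "0 \<le> r * (norm x0)\<^sup>2"
    by (rule order_trans[OF zero_le_power2 r])
  then have r0: "0 \<le> r"
    using n0 by (simp add: zero_le_mult_iff)
  have "norm (A x) \<le> sqrt r * norm x" for x
    using r[of x] r0 by (intro power2_le_imp_le[OF _ mult_nonneg_nonneg]) (auto simp: power_mult_distrib)
  then have "K \<le> sqrt r"
    unfolding K_def by (rule onorm_bound[rotated]) (use r0 in simp)
  also have "\<dots> < sqrt (K\<^sup>2)"
    using e Kp by (intro real_sqrt_less_mono) (simp add: r_def)
  finally show False using Kp by simp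
qed

section \<open>The Hilbert space of square-summable functions\<close>

lemma ell2_abs_summable_mult:
  assumes "\<phi> \<in> ell2" "\<psi> \<in> ell2"
  shows "(\<lambda>n. norm (cnj (\<phi> n) * \<psi> n)) summable_on UNIV"
proof (rule summable_on_comparison_test)
  show "(\<lambda>n. (cmod (\<phi> n))\<^sup>2 + (cmod (\<psi> n))\<^sup>2) summable_on UNIV"
    using assms by (intro summable_on_add) (auto simp: ell2_def)
  show "norm (cnj (\<phi> n) * \<psi> n) \<le> (cmod (\<phi> n))\<^sup>2 + (cmod (\<psi> n))\<^sup>2" for n
  proof -
    have "0 \<le> (cmod (\<phi> n) - cmod (\<psi> n))\<^sup>2 + (cmod (\<phi> n))\<^sup>2 + (cmod (\<psi> n))\<^sup>2" by simp
    then show ?thesis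
      by (simp add: norm_mult power2_diff)
  qed
qed simp

lemma ell2_summable_mult:
  "\<phi> \<in> ell2 \<Longrightarrow> \<psi> \<in> ell2 \<Longrightarrow> (\<lambda>n. cnj (\<phi> n) * \<psi> n) summable_on UNIV"
  by (rule Infinite_Sum.abs_summable_summable[OF ell2_abs_summable_mult])

lemma ell2_zero [simp]: "(\<lambda>n. 0) \<in> ell2"
  by (simp add: ell2_def)

lemma ell2_scale [simp]: "\<psi> \<in> ell2 \<Longrightarrow> (\<lambda>n. c * \<psi> n) \<in> ell2"
  by (auto simp: ell2_def norm_mult power_mult_distrib intro: summable_on_cmult_right)

lemma ell2_comparison:
  assumes "\<psi> \<in> ell2" "\<And>n. cmod (\<phi> n) \<le> cmod (\<psi> n)"
  shows "\<phi> \<in> ell2"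
proof -
  have "(\<lambda>n. (cmod (\<psi> n))\<^sup>2) summable_on UNIV"
    using assms(1) by (simp add: ell2_def)
  then have "(\<lambda>n. (cmod (\<phi> n))\<^sup>2) summable_on UNIV"
    by (rule summable_on_comparison_test) (use assms(2) in \<open>auto intro: power_mono\<close>)
  then show ?thesis by (simp add: ell2_def)
qed

lemma ell2_add [simp]:
  assumes "\<phi> \<in> ell2" "\<psi> \<in> ell2"
  shows "(\<lambda>n. \<phi> n + \<psi> n) \<in> ell2"
proof -
  have "(\<lambda>n. 2 * ((cmod (\<phi> n))\<^sup>2 + (cmod (\<psi> n))\<^sup>2)) summable_on UNIV"
    using assms by (intro summable_on_add summable_on_cmult_right) (auto simp: ell2_def)
  moreover have "(cmod (\<phi> n + \<psi> n))\<^sup>2 \<le> 2 * ((cmod (\<phi> n))\<^sup>2 + (cmod (\<psi> n))\<^sup>2)" for n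
  proof -
    have "(cmod (\<phi> n + \<psi> n))\<^sup>2 \<le> (cmod (\<phi> n) + cmod (\<psi> n))\<^sup>2"
      by (intro power_mono norm_triangle_ineq) simp
    moreover have "0 \<le> (cmod (\<phi> n) - cmod (\<psi> n))\<^sup>2" by simp
    ultimately show ?thesis
      unfolding power2_sum power2_diff distrib_left by linarith
  qed
  ultimately have "(\<lambda>n. (cmod (\<phi> n + \<psi> n))\<^sup>2) summable_on UNIV"
    by (rule summable_on_comparison_test) auto
  then show ?thesis by (simp add: ell2_def)
qed

lemma ell2_uminus [simp]: "\<psi> \<in> ell2 \<Longrightarrow> (\<lambda>n. - \<psi> n) \<in> ell2"
  using ell2_scale[of \<psi> "-1"] by simp

lemma ell2_diff [simp]: "\<phi> \<in> ell2 \<Longrightarrow> \<psi> \<in> ell2 \<Longrightarrow> (\<lambda>n. \<phi> n - \<psi> n) \<in> ell2"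
  using ell2_add[of \<phi> "\<lambda>n. - \<psi> n"] by simp

lemma ell2_finite_support:
  assumes "finite {n. \<psi> n \<noteq> 0}"
  shows "\<psi> \<in> ell2"
  using assms unfolding ell2_def by (auto intro: finite_nonzero_values_imp_summable_on)

lemma ell2_inner_add:
  "\<phi> \<in> ell2 \<Longrightarrow> \<psi> \<in> ell2 \<Longrightarrow> \<eta> \<in> ell2 \<Longrightarrow>
    ell2_inner (\<lambda>n. \<phi> n + \<psi> n) \<eta> = ell2_inner \<phi> \<eta> + ell2_inner \<psi> \<eta>"
  unfolding ell2_inner_def
  by (simp add: distrib_right infsum_add ell2_summable_mult)

lemma ell2_inner_scale_left: "ell2_inner (\<lambda>n. c * \<phi> n) \<psi> = cnj c * ell2_inner \<phi> \<psi>"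
  unfolding ell2_inner_def by (simp add: mult.assoc infsum_cmult_right')

lemma ell2_inner_scale_right: "ell2_inner \<phi> (\<lambda>n. c * \<psi> n) = c * ell2_inner \<phi> \<psi>"
  unfolding ell2_inner_def by (simp add: mult.left_commute[of _ c] infsum_cmult_right')

lemma ell2_inner_commute: "ell2_inner \<phi> \<psi> = cnj (ell2_inner \<psi> \<phi>)"
  unfolding ell2_inner_def by (simp flip: infsum_cnj add: mult.commute)

lemma Re_ell2_inner_commute: "Re (ell2_inner \<phi> \<psi>) = Re (ell2_inner \<psi> \<phi>)"
  by (subst ell2_inner_commute) simp

lemma ell2_inner_self:
  assumes "\<psi> \<in> ell2"
  shows "ell2_inner \<psi> \<psi> = of_real (\<Sum>\<^sub>\<infinity>n. (cmod (\<psi> n))\<^sup>2)"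
proof -
  have "ell2_inner \<psi> \<psi> = (\<Sum>\<^sub>\<infinity>n. complex_of_real ((cmod (\<psi> n))\<^sup>2))"
    unfolding ell2_inner_def by (simp only: complex_norm_square mult.commute)
  also have "\<dots> = of_real (\<Sum>\<^sub>\<infinity>n. (cmod (\<psi> n))\<^sup>2)"
    using assms unfolding ell2_def by (intro infsumI has_sum_of_real has_sum_infsum) auto
  finally show ?thesis .
qed

text \<open>A type is required because Banach's fixed point theorem and \<open>onorm\<close> are
  stated for type classes. The real part of the inner product is enough: it induces the same norm,
  and only real shifts of the operator are treated on this type.\<close>

typedef 'a l2 = "ell2 :: ('a \<Rightarrow> complex) set"
  morphisms l2_apply l2_of
  by (rule exI[of _ "\<lambda>n. 0"]) simp

setup_lifting type_definition_l2

instantiation l2 :: (type) real_inner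
begin

lift_definition zero_l2 :: "'a l2" is "\<lambda>n. 0" by simp
lift_definition plus_l2 :: "'a l2 \<Rightarrow> 'a l2 \<Rightarrow> 'a l2" is "\<lambda>\<phi> \<psi> n. \<phi> n + \<psi> n" by simp
lift_definition minus_l2 :: "'a l2 \<Rightarrow> 'a l2 \<Rightarrow> 'a l2" is "\<lambda>\<phi> \<psi> n. \<phi> n - \<psi> n" by simp
lift_definition uminus_l2 :: "'a l2 \<Rightarrow> 'a l2" is "\<lambda>\<phi> n. - \<phi> n" by simp
lift_definition scaleR_l2 :: "real \<Rightarrow> 'a l2 \<Rightarrow> 'a l2" is "\<lambda>r \<phi> n. complex_of_real r * \<phi> n" by simp
lift_definition inner_l2 :: "'a l2 \<Rightarrow> 'a l2 \<Rightarrow> real" is "\<lambda>\<phi> \<psi>. Re (ell2_inner \<phi> \<psi>)" .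
lift_definition norm_l2 :: "'a l2 \<Rightarrow> real" is ell2_norm .
definition "sgn_l2 (x :: 'a l2) = inverse (norm x) *\<^sub>R x"
definition "dist_l2 (x :: 'a l2) y = norm (x - y)"
definition "uniformity_l2 = (INF e\<in>{0<..}. principal {(x :: 'a l2, y). dist x y < e})"
definition "open_l2 U = (\<forall>x\<in>U. eventually (\<lambda>(x', y :: 'a l2). x' = x \<longrightarrow> y \<in> U) uniformity)"

instance
proof
  fix x y z :: "'a l2" and r s :: real
  show "x + y + z = x + (y + z)" by transfer (simp add: add.assoc)
  show "x + y = y + x" by transfer (simp add: add.commute)
  show "0 + x = x" by transfer simp
  show "- x + x = 0" by transfer simp
  show "x - y = x + - y" by transfer simp
  show "r *\<^sub>R (x + y) = r *\<^sub>R x + r *\<^sub>R y" by transfer (simp add: distrib_left)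
  show "(r + s) *\<^sub>R x = r *\<^sub>R x + s *\<^sub>R x" by transfer (simp add: distrib_right)
  show "r *\<^sub>R s *\<^sub>R x = (r * s) *\<^sub>R x" by transfer (simp add: mult.assoc)
  show "1 *\<^sub>R x = x" by transfer simp
  show "dist x y = norm (x - y)" by (simp add: dist_l2_def)
  show "sgn x = inverse (norm x) *\<^sub>R x" by (simp add: sgn_l2_def)
  show "(uniformity :: ('a l2 \<times> 'a l2) filter) = (INF e\<in>{0<..}. principal {(x, y). dist x y < e})"
    by (simp add: uniformity_l2_def)
  show "open U = (\<forall>x\<in>U. eventually (\<lambda>(x', y). x' = x \<longrightarrow> y \<in> U) uniformity)" for U :: "'a l2 set"
    by (simp add: open_l2_def)
  show "inner x y = inner y x"
    by transfer (rule Re_ell2_inner_commute)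
  show "inner (x + y) z = inner x z + inner y z"
    by transfer (simp add: ell2_inner_add)
  show "inner (r *\<^sub>R x) y = r * inner x y"
    by transfer (simp add: ell2_inner_scale_left)
  show "0 \<le> inner x x"
    by transfer (simp add: ell2_inner_self infsum_nonneg)
  show "(inner x x = 0) = (x = 0)"
  proof (transfer, intro iffI)
    fix \<psi> :: "'a \<Rightarrow> complex"
    assume \<psi>: "\<psi> \<in> ell2" "Re (ell2_inner \<psi> \<psi>) = 0"
    then have "(\<Sum>\<^sub>\<infinity>n. (cmod (\<psi> n))\<^sup>2) \<le> 0" "(\<lambda>n. (cmod (\<psi> n))\<^sup>2) summable_on UNIV"
      by (auto simp: ell2_inner_self ell2_def)
    then have "(cmod (\<psi> n))\<^sup>2 = 0" for n
      by (rule nonneg_infsum_le_0D) auto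
    then show "\<psi> = (\<lambda>n. 0)" by auto
  qed (simp add: ell2_inner_def)
  show "norm x = sqrt (inner x x)"
    by transfer (simp add: ell2_norm_def ell2_inner_self)
qed

end

lemma ell2_norm_power2: "(ell2_norm \<psi>)\<^sup>2 = (\<Sum>\<^sub>\<infinity>n. (cmod (\<psi> n))\<^sup>2)"
  by (simp add: ell2_norm_def infsum_nonneg)

lemma sum_le_ell2_norm:
  assumes "\<psi> \<in> ell2" "finite F"
  shows "(\<Sum>n\<in>F. (cmod (\<psi> n))\<^sup>2) \<le> (ell2_norm \<psi>)\<^sup>2"
  unfolding ell2_norm_power2
  by (rule finite_sum_le_infsum) (use assms in \<open>auto simp: ell2_def\<close>)

lemma ell2_norm_nonneg [simp]: "0 \<le> ell2_norm \<psi>"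
  by (simp add: ell2_norm_def infsum_nonneg)

lemma cmod_le_ell2_norm:
  assumes "\<psi> \<in> ell2"
  shows "cmod (\<psi> n) \<le> ell2_norm \<psi>"
  by (rule power2_le_imp_le) (use sum_le_ell2_norm[OF assms, of "{n}"] in simp_all)

lemma cmod_l2_apply_le: "cmod (l2_apply x n) \<le> norm x"
  by transfer (rule cmod_le_ell2_norm)

text \<open>Membership and a norm bound follow together from finite partial sums, which is how
  pointwise limits, truncation errors and the exponential weight are handled.\<close>

lemma ell2_normI:
  assumes "\<And>F. finite F \<Longrightarrow> (\<Sum>n\<in>F. (cmod (\<psi> n))\<^sup>2) \<le> r\<^sup>2" "0 \<le> r"
  shows "\<psi> \<in> ell2" "ell2_norm \<psi> \<le> r"
proof -
  have s: "(\<lambda>n. (cmod (\<psi> n))\<^sup>2) summable_on UNIV"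
    using assms by (intro nonneg_bdd_above_summable_on bdd_aboveI[of _ "r\<^sup>2"]) auto
  then show "\<psi> \<in> ell2" by (simp add: ell2_def)
  have "(ell2_norm \<psi>)\<^sup>2 \<le> r\<^sup>2"
    unfolding ell2_norm_power2 using assms by (intro infsum_le_finite_sums s)
  then show "ell2_norm \<psi> \<le> r"
    using assms(2) by (rule power2_le_imp_le)
qed

instance l2 :: (type) complete_space
proof
  fix X :: "nat \<Rightarrow> 'a l2"
  assume X: "Cauchy X"
  have "Cauchy (\<lambda>k. l2_apply (X k) n)" for n
  proof (rule metric_CauchyI)
    fix e :: real assume "e > 0"
    then obtain M where "\<forall>k\<ge>M. \<forall>m\<ge>M. dist (X k) (X m) < e"
      using X unfolding Cauchy_def by blast
    moreover have "dist (l2_apply (X k) n) (l2_apply (X m) n) \<le> dist (X k) (X m)" for k m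
      using cmod_l2_apply_le[of "X k - X m" n] by (simp add: dist_norm minus_l2.rep_eq)
    ultimately show "\<exists>M. \<forall>k\<ge>M. \<forall>m\<ge>M. dist (l2_apply (X k) n) (l2_apply (X m) n) < e"
      by (meson order_le_less_trans)
  qed
  then obtain L where L: "(\<lambda>k. l2_apply (X k) n) \<longlonglongrightarrow> L n" for n
    unfolding Cauchy_convergent_iff convergent_def by metis
  \<comment> \<open>Fatou's argument: a finite partial sum of the difference to the pointwise limit
    \<open>L\<close> is a limit of partial sums that are eventually bounded by
    \<open>e\<^sup>2\<close>.\<close>
  have *: "(\<lambda>n. l2_apply (X k) n - L n) \<in> ell2 \<and> ell2_norm (\<lambda>n. l2_apply (X k) n - L n) \<le> e"
    if e: "e > 0" and M: "\<And>m. m \<ge> M \<Longrightarrow> dist (X k) (X m) < e" for k e M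
  proof -
    have "(\<Sum>n\<in>F. (cmod (l2_apply (X k) n - L n))\<^sup>2) \<le> e\<^sup>2" if "finite F" for F
    proof (rule tendsto_upperbound)
      show "(\<lambda>m. \<Sum>n\<in>F. (cmod (l2_apply (X k) n - l2_apply (X m) n))\<^sup>2)
          \<longlonglongrightarrow> (\<Sum>n\<in>F. (cmod (l2_apply (X k) n - L n))\<^sup>2)"
        by (intro tendsto_intros L)
      have "(\<Sum>n\<in>F. (cmod (l2_apply (X k) n - l2_apply (X m) n))\<^sup>2) \<le> e\<^sup>2" if "m \<ge> M" for m
      proof -
        have "(\<Sum>n\<in>F. (cmod (l2_apply (X k) n - l2_apply (X m) n))\<^sup>2) \<le> (norm (X k - X m))\<^sup>2"
          using sum_le_ell2_norm[OF l2_apply[of "X k - X m"] \<open>finite F\<close>]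
          by (simp add: minus_l2.rep_eq norm_l2.rep_eq)
        also have "\<dots> \<le> e\<^sup>2"
          using M[OF that] by (intro power_mono) (auto simp: dist_norm)
        finally show ?thesis .
      qed
      then show "\<forall>\<^sub>F m in sequentially. (\<Sum>n\<in>F. (cmod (l2_apply (X k) n - l2_apply (X m) n))\<^sup>2) \<le> e\<^sup>2"
        by (auto simp: eventually_sequentially)
    qed simp
    with e show ?thesis
      using ell2_normI[of "\<lambda>n. l2_apply (X k) n - L n" e] by auto
  qed
  have L2: "L \<in> ell2"
  proof -
    obtain M where M: "\<forall>k\<ge>M. \<forall>m\<ge>M. dist (X k) (X m) < 1"
      using metric_CauchyD[OF X, of 1] by auto
    then have "(\<lambda>n. l2_apply (X M) n - L n) \<in> ell2"
      using *[of 1 M M] by auto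
    then have "(\<lambda>n. l2_apply (X M) n - (l2_apply (X M) n - L n)) \<in> ell2"
      by (rule ell2_diff[OF l2_apply])
    then show ?thesis by simp
  qed
  have "X \<longlonglongrightarrow> l2_of L"
  proof (rule metric_LIMSEQ_I)
    fix r :: real assume r: "r > 0"
    then obtain M where M: "\<forall>k\<ge>M. \<forall>m\<ge>M. dist (X k) (X m) < r / 2"
      using X unfolding Cauchy_def by (meson half_gt_zero)
    have "dist (X k) (l2_of L) < r" if "k \<ge> M" for k
    proof -
      have "ell2_norm (\<lambda>n. l2_apply (X k) n - L n) \<le> r / 2"
        using *[of "r / 2" M k] M that r by auto
      then show ?thesis
        using r by (simp add: dist_norm norm_l2.rep_eq minus_l2.rep_eq l2_of_inverse L2)
    qed
    then show "\<exists>M. \<forall>k\<ge>M. dist (X k) (l2_of L) < r" by blast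
  qed
  then show "convergent X" by (auto simp: convergent_def)
qed


section \<open>Bounded self-adjoint operators\<close>

lemma ell2_norm_add: "\<phi> \<in> ell2 \<Longrightarrow> \<psi> \<in> ell2 \<Longrightarrow> ell2_norm (\<lambda>n. \<phi> n + \<psi> n) \<le> ell2_norm \<phi> + ell2_norm \<psi>"
  using norm_triangle_ineq[of "l2_of \<phi>" "l2_of \<psi>"]
  by (simp add: norm_l2.rep_eq plus_l2.rep_eq l2_of_inverse)

lemma ell2_norm_scale: "ell2_norm (\<lambda>n. c * \<psi> n) = cmod c * ell2_norm \<psi>"
  by (simp add: ell2_norm_def norm_mult power_mult_distrib infsum_cmult_right' real_sqrt_mult)

lemma ell2_norm_zero [simp]: "ell2_norm (\<lambda>n. 0) = 0"
  by (simp add: ell2_norm_def)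

lemma ell2_norm_eq_0_iff: "\<psi> \<in> ell2 \<Longrightarrow> ell2_norm \<psi> = 0 \<longleftrightarrow> \<psi> = (\<lambda>n. 0)"
  using cmod_le_ell2_norm[of \<psi>] by (auto simp: fun_eq_iff ell2_norm_def)

lemma ell2_norm_mono:
  assumes "\<psi> \<in> ell2" "\<And>n. cmod (\<phi> n) \<le> cmod (\<psi> n)"
  shows "ell2_norm \<phi> \<le> ell2_norm \<psi>"
  using assms ell2_comparison[OF assms] unfolding ell2_norm_def ell2_def
  by (auto intro!: infsum_mono power_mono)

lemma bounded_op_D:
  assumes "bounded_op T"
  shows "\<psi> \<in> ell2 \<Longrightarrow> T \<psi> \<in> ell2"
    and "\<phi> \<in> ell2 \<Longrightarrow> \<psi> \<in> ell2 \<Longrightarrow> T (\<lambda>n. \<phi> n + \<psi> n) = (\<lambda>n. T \<phi> n + T \<psi> n)"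
    and "\<psi> \<in> ell2 \<Longrightarrow> T (\<lambda>n. c * \<psi> n) = (\<lambda>n. c * T \<psi> n)"
  using assms unfolding bounded_op_def by blast+

lemma bounded_op_norm:
  assumes "bounded_op T"
  obtains C where "C > 0" "\<And>\<psi>. \<psi> \<in> ell2 \<Longrightarrow> ell2_norm (T \<psi>) \<le> C * ell2_norm \<psi>"
proof -
  obtain C where C: "\<And>\<psi>. \<psi> \<in> ell2 \<Longrightarrow> ell2_norm (T \<psi>) \<le> C * ell2_norm \<psi>"
    using assms unfolding bounded_op_def by blast
  have "ell2_norm (T \<psi>) \<le> max C 1 * ell2_norm \<psi>" if "\<psi> \<in> ell2" for \<psi>
    by (rule order_trans[OF C[OF that]]) (simp add: mult_right_mono)
  then show ?thesis by (intro that[of "max C 1"]) auto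
qed

lemma bounded_op_shift:
  assumes "bounded_op T"
  shows "bounded_op (\<lambda>\<psi> n. T \<psi> n - z * \<psi> n)"
proof -
  note T = bounded_op_D[OF assms]
  obtain C where C: "\<And>\<psi>. \<psi> \<in> ell2 \<Longrightarrow> ell2_norm (T \<psi>) \<le> C * ell2_norm \<psi>"
    using bounded_op_norm[OF assms] by blast
  have "ell2_norm (\<lambda>n. T \<psi> n - z * \<psi> n) \<le> (C + cmod z) * ell2_norm \<psi>" if "\<psi> \<in> ell2" for \<psi>
    using ell2_norm_add[of "T \<psi>" "\<lambda>n. - z * \<psi> n"] ell2_norm_scale[of "- z" \<psi>] C[OF that] T(1)[OF that]
      ell2_scale[OF that, of "- z"]
    by (simp add: distrib_right)
  then have "\<exists>C. \<forall>\<psi>\<in>ell2. ell2_norm (\<lambda>n. T \<psi> n - z * \<psi> n) \<le> C * ell2_norm \<psi>"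
    by blast
  then show ?thesis
    unfolding bounded_op_def by (simp add: T algebra_simps)
qed

text \<open>Its negation says that \<open>z\<close> has approximate eigenvectors. For self-adjoint
  \<open>T\<close> and real \<open>z\<close> it characterises the resolvent set.\<close>

definition bounded_below_op :: "(('a \<Rightarrow> complex) \<Rightarrow> ('a \<Rightarrow> complex)) \<Rightarrow> complex \<Rightarrow> bool" where
  "bounded_below_op T z \<longleftrightarrow>
     (\<exists>c>0. \<forall>\<psi>\<in>ell2. c * ell2_norm \<psi> \<le> ell2_norm (\<lambda>n. T \<psi> n - z * \<psi> n))"

definition op_l2 :: "(('a \<Rightarrow> complex) \<Rightarrow> ('a \<Rightarrow> complex)) \<Rightarrow> 'a l2 \<Rightarrow> 'a l2" where
  "op_l2 T x = l2_of (T (l2_apply x))"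

lemma l2_apply_op_l2: "bounded_op T \<Longrightarrow> l2_apply (op_l2 T x) = T (l2_apply x)"
  by (simp add: op_l2_def l2_of_inverse bounded_op_D l2_apply)

lemma bounded_linear_op_l2:
  assumes "bounded_op T"
  shows "bounded_linear (op_l2 T)"
proof -
  obtain C where C: "\<And>\<psi>. \<psi> \<in> ell2 \<Longrightarrow> ell2_norm (T \<psi>) \<le> C * ell2_norm \<psi>"
    using bounded_op_norm[OF assms] by blast
  show ?thesis
  proof (rule bounded_linear_intro[where K = C])
    show "op_l2 T (x + y) = op_l2 T x + op_l2 T y" for x y
      unfolding l2_apply_inject[symmetric]
      by (simp add: l2_apply_op_l2[OF assms] plus_l2.rep_eq bounded_op_D[OF assms] l2_apply)
    show "op_l2 T (r *\<^sub>R x) = r *\<^sub>R op_l2 T x" for r x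
      unfolding l2_apply_inject[symmetric]
      by (simp add: l2_apply_op_l2[OF assms] scaleR_l2.rep_eq bounded_op_D[OF assms] l2_apply)
    show "norm (op_l2 T x) \<le> norm x * C" for x
      using C[OF l2_apply, of x] by (simp add: norm_l2.rep_eq l2_apply_op_l2[OF assms] mult.commute)
  qed
qed

lemma bounded_below_op_iff_l2:
  assumes "bounded_op T"
  shows "bounded_below_op T (of_real x) \<longleftrightarrow> (\<exists>c>0. \<forall>y. c * norm y \<le> norm (op_l2 T y - x *\<^sub>R y))"
proof -
  have "norm (op_l2 T y - x *\<^sub>R y) = ell2_norm (\<lambda>n. T (l2_apply y) n - of_real x * l2_apply y n)" for y
    by (simp add: norm_l2.rep_eq minus_l2.rep_eq scaleR_l2.rep_eq l2_apply_op_l2[OF assms])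
  then have "(\<forall>y. c * norm y \<le> norm (op_l2 T y - x *\<^sub>R y)) \<longleftrightarrow>
      (\<forall>\<psi>\<in>ell2. c * ell2_norm \<psi> \<le> ell2_norm (\<lambda>n. T \<psi> n - of_real x * \<psi> n))" for c
    by (metis norm_l2.rep_eq l2_apply l2_of_inverse)
  then show ?thesis
    by (simp add: bounded_below_op_def)
qed

lemma op_l2_shift_symmetric:
  assumes "bounded_op T" "selfadjoint_op T"
  shows "inner (op_l2 T y - x *\<^sub>R y) z = inner y (op_l2 T z - x *\<^sub>R z)"
proof -
  have "inner (op_l2 T y) z = inner y (op_l2 T z)"
    using assms(2) by (simp add: inner_l2.rep_eq l2_apply_op_l2[OF assms(1)] selfadjoint_op_def l2_apply)
  then show ?thesis
    by (simp add: inner_diff_left inner_diff_right)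
qed

text \<open>An inverse with bound \<open>C\<close> gives the lower bound \<open>1 / C\<close>.
  Conversely, a lower bound gives injectivity, and since \<open>x\<close> is real the shifted
  operator is still symmetric, so that it is also surjective.\<close>

lemma not_in_spec_iff:
  assumes T: "bounded_op T" "selfadjoint_op T"
  shows "x \<notin> spec T \<longleftrightarrow> bounded_below_op T (of_real x)"
proof
  assume "x \<notin> spec T"
  then obtain S where S: "bounded_op S" "\<forall>\<psi>\<in>ell2. S (\<lambda>n. T \<psi> n - of_real x * \<psi> n) = \<psi>"
    unfolding spec_def op_spectrum_def by auto
  obtain C where C: "C > 0" "\<And>\<psi>. \<psi> \<in> ell2 \<Longrightarrow> ell2_norm (S \<psi>) \<le> C * ell2_norm \<psi>"
    using bounded_op_norm[OF S(1)] by blast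
  have "1 / C * ell2_norm \<psi> \<le> ell2_norm (\<lambda>n. T \<psi> n - of_real x * \<psi> n)" if "\<psi> \<in> ell2" for \<psi>
    using C(2)[of "\<lambda>n. T \<psi> n - of_real x * \<psi> n"] S(2) that C(1)
    by (simp add: field_simps bounded_op_D[OF T(1)])
  then show "bounded_below_op T (of_real x)"
    unfolding bounded_below_op_def using C(1) by (intro exI[of _ "1 / C"]) auto
next
  assume bb: "bounded_below_op T (of_real x)"
  define B where "B = (\<lambda>\<psi> n. T \<psi> n - of_real x * \<psi> n)"
  have B: "bounded_op B"
    unfolding B_def by (rule bounded_op_shift[OF T(1)])
  note BD = bounded_op_D[OF B]
  obtain c where c: "c > 0" "\<And>\<psi>. \<psi> \<in> ell2 \<Longrightarrow> c * ell2_norm \<psi> \<le> ell2_norm (B \<psi>)"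
    using bb unfolding bounded_below_op_def B_def by blast
  have inj: "\<phi> = \<psi>" if "\<phi> \<in> ell2" "\<psi> \<in> ell2" "B \<phi> = B \<psi>" for \<phi> \<psi>
  proof -
    have "B (\<lambda>n. \<phi> n + (- 1) * \<psi> n) = (\<lambda>n. B \<phi> n + (- 1) * B \<psi> n)"
      using that(1,2) by (subst BD(2)) (simp_all only: BD(3) ell2_scale)
    then have "B (\<lambda>n. \<phi> n - \<psi> n) = (\<lambda>n. 0)"
      using that(3) by simp
    then have "c * ell2_norm (\<lambda>n. \<phi> n - \<psi> n) \<le> 0"
      using c(2)[of "\<lambda>n. \<phi> n - \<psi> n"] that by simp
    then have "ell2_norm (\<lambda>n. \<phi> n - \<psi> n) = 0"
      using c(1) by (simp add: mult_le_0_iff antisym)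
    then show ?thesis
      using that by (simp add: ell2_norm_eq_0_iff fun_eq_iff)
  qed
  have surj: "\<exists>\<psi>\<in>ell2. B \<psi> = \<phi>" if "\<phi> \<in> ell2" for \<phi>
  proof -
    obtain c where "c > 0" "\<And>y. c * norm y \<le> norm (op_l2 T y - x *\<^sub>R y)"
      using bb unfolding bounded_below_op_iff_l2[OF T(1)] by blast
    then have "surj (\<lambda>y. op_l2 T y - x *\<^sub>R y)"
      by (intro symmetric_bounded_below_surj[where c = c] op_l2_shift_symmetric T bounded_linear_sub
          bounded_linear_op_l2 bounded_linear_scaleR_right)
    then obtain y where "l2_of \<phi> = op_l2 T y - x *\<^sub>R y"
      by (auto simp: surj_def)
    then have "l2_apply (l2_of \<phi>) = B (l2_apply y)"
      by (simp add: minus_l2.rep_eq scaleR_l2.rep_eq l2_apply_op_l2[OF T(1)] B_def)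
    then show ?thesis
      using that l2_apply[of y] by (auto simp: l2_of_inverse)
  qed
  \<comment> \<open>\<open>S\<close> is chosen pointwise, so its linearity has to be recovered by
    applying \<open>B\<close> to both sides and using \<open>inj\<close>.\<close>
  then obtain S where S: "\<And>\<phi>. \<phi> \<in> ell2 \<Longrightarrow> S \<phi> \<in> ell2" "\<And>\<phi>. \<phi> \<in> ell2 \<Longrightarrow> B (S \<phi>) = \<phi>"
    by metis
  have "bounded_op S"
    unfolding bounded_op_def
  proof (intro conjI ballI allI)
    fix \<phi> \<psi> :: "'a \<Rightarrow> complex" assume "\<phi> \<in> ell2" "\<psi> \<in> ell2"
    then show "S (\<lambda>n. \<phi> n + \<psi> n) = (\<lambda>n. S \<phi> n + S \<psi> n)"
      by - (rule inj, simp_all add: S BD)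
  next
    fix c and \<psi> :: "'a \<Rightarrow> complex" assume "\<psi> \<in> ell2"
    then show "S (\<lambda>n. c * \<psi> n) = (\<lambda>n. c * S \<psi> n)"
      by - (rule inj, simp_all add: S BD)
  next
    have "ell2_norm (S \<psi>) \<le> 1 / c * ell2_norm \<psi>" if "\<psi> \<in> ell2" for \<psi>
      using c(2)[OF S(1)[OF that]] c(1) by (simp add: S that field_simps)
    then show "\<exists>C. \<forall>\<psi>\<in>ell2. ell2_norm (S \<psi>) \<le> C * ell2_norm \<psi>" by blast
  qed (simp add: S)
  moreover have "S (B \<psi>) = \<psi>" if "\<psi> \<in> ell2" for \<psi>
    by (rule inj) (simp_all add: S BD that)
  ultimately show "x \<notin> spec T"
    unfolding spec_def op_spectrum_def using S(2) by (auto simp: B_def)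
qed

text \<open>A lower bound \<open>c\<close> at \<open>x\<close> leaves
  \<open>c - \<bar>y - x\<bar>\<close> at \<open>y\<close>, so the complement is open. Beyond an
  operator bound \<open>C\<close>, the term \<open>x * \<psi>\<close> dominates and leaves the lower
  bound \<open>\<bar>x\<bar> - C\<close>.\<close>

lemma compact_spec:
  assumes T: "bounded_op T" "selfadjoint_op T"
  shows "compact (spec T)"
proof -
  note TD = bounded_op_D[OF T(1)]
  have "open (- spec T)"
    unfolding open_dist
  proof
    fix x assume "x \<in> - spec T"
    then obtain c where c: "c > 0"
      "\<And>\<psi>. \<psi> \<in> ell2 \<Longrightarrow> c * ell2_norm \<psi> \<le> ell2_norm (\<lambda>n. T \<psi> n - of_real x * \<psi> n)"
      using not_in_spec_iff[OF T] by (auto simp: bounded_below_op_def)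
    have "y \<notin> spec T" if "dist y x < c" for y
    proof -
      have "(c - \<bar>y - x\<bar>) * ell2_norm \<psi> \<le> ell2_norm (\<lambda>n. T \<psi> n - of_real y * \<psi> n)" if \<psi>: "\<psi> \<in> ell2" for \<psi>
      proof -
        have "ell2_norm (\<lambda>n. T \<psi> n - of_real x * \<psi> n) =
            ell2_norm (\<lambda>n. (T \<psi> n - of_real y * \<psi> n) + of_real (y - x) * \<psi> n)"
          by (simp add: algebra_simps)
        also have "\<dots> \<le> ell2_norm (\<lambda>n. T \<psi> n - of_real y * \<psi> n) + ell2_norm (\<lambda>n. of_real (y - x) * \<psi> n)"
          using \<psi> by (intro ell2_norm_add ell2_diff ell2_scale TD)
        also have "ell2_norm (\<lambda>n. of_real (y - x) * \<psi> n) = \<bar>y - x\<bar> * ell2_norm \<psi>"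
          by (simp only: ell2_norm_scale norm_of_real)
        finally show ?thesis
          using c(2)[OF \<psi>] by (simp add: left_diff_distrib)
      qed
      moreover have "c - \<bar>y - x\<bar> > 0" using that by (simp add: dist_real_def)
      ultimately show ?thesis
        unfolding not_in_spec_iff[OF T] bounded_below_op_def by blast
    qed
    then show "\<exists>e>0. \<forall>y. dist y x < e \<longrightarrow> y \<in> - spec T"
      using c(1) by auto
  qed
  then have "closed (spec T)" by (simp add: closed_def)
  moreover have "bounded (spec T)"
  proof -
    obtain C where C: "\<And>\<psi>. \<psi> \<in> ell2 \<Longrightarrow> ell2_norm (T \<psi>) \<le> C * ell2_norm \<psi>"
      using bounded_op_norm[OF T(1)] by blast
    have "\<bar>x\<bar> \<le> C" if "x \<in> spec T" for x
    proof (rule ccontr)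
      assume "\<not> \<bar>x\<bar> \<le> C"
      moreover have "(\<bar>x\<bar> - C) * ell2_norm \<psi> \<le> ell2_norm (\<lambda>n. T \<psi> n - of_real x * \<psi> n)" if \<psi>: "\<psi> \<in> ell2" for \<psi>
      proof -
        have "\<bar>x\<bar> * ell2_norm \<psi> = ell2_norm (\<lambda>n. of_real x * \<psi> n)"
          by (simp only: ell2_norm_scale norm_of_real)
        also have "\<dots> = ell2_norm (\<lambda>n. (-1) * (T \<psi> n - of_real x * \<psi> n) + T \<psi> n)"
          by simp
        also have "\<dots> \<le> ell2_norm (\<lambda>n. (-1) * (T \<psi> n - of_real x * \<psi> n)) + ell2_norm (T \<psi>)"
          using \<psi> by (intro ell2_norm_add ell2_diff ell2_scale TD)
        also have "\<dots> \<le> ell2_norm (\<lambda>n. T \<psi> n - of_real x * \<psi> n) + C * ell2_norm \<psi>"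
          using C[OF \<psi>] by (simp only: ell2_norm_scale) simp
        finally show ?thesis
          by (simp add: left_diff_distrib)
      qed
      ultimately show False
        using that not_in_spec_iff[OF T, of x] unfolding bounded_below_op_def
        by (metis diff_gt_0_iff_gt not_le)
    qed
    then show ?thesis
      unfolding bounded_iff by auto
  qed
  ultimately show ?thesis
    by (simp add: compact_eq_bounded_closed)
qed

text \<open>The Hausdorff distance has its usual meaning only for nonempty sets. A point mass
  provides the nonzero vector that \<open>symmetric_spectrum_nonempty\<close> asks for.\<close>

lemma spec_nonempty:
  assumes T: "bounded_op T" "selfadjoint_op T"
  shows "spec T \<noteq> {}"
proof -
  let ?e = "l2_of (\<lambda>n. if n = (undefined::'a) then 1 else 0)"
  have "(\<lambda>n. if n = (undefined::'a) then 1 else (0::complex)) \<in> ell2"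
    by (rule ell2_finite_support) simp
  then have "l2_apply ?e undefined = 1"
    by (simp add: l2_of_inverse)
  then have "?e \<noteq> 0"
    by (auto simp: zero_l2.rep_eq)
  then obtain s where "\<not> (\<exists>c>0. \<forall>y. c * norm y \<le> norm (op_l2 T y - s *\<^sub>R y))"
    using symmetric_spectrum_nonempty[OF bounded_linear_op_l2[OF T(1)] _ \<open>?e \<noteq> 0\<close>]
      op_l2_shift_symmetric[OF T, where x = 0] by force
  then have "s \<in> spec T"
    using not_in_spec_iff[OF T] bounded_below_op_iff_l2[OF T(1)] by blast
  then show ?thesis by auto
qed

text \<open>The parts \<open>B\<close> and \<open>J\<close> of \<open>T \<psi> - z * \<psi>\<close>
  coming from \<open>Re z\<close> and \<open>Im z\<close> are orthogonal in the real inner product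
  because the quadratic form of \<open>T\<close> is real, so by Pythagoras
  \<open>\<bar>Im z\<bar>\<close> is a lower bound. Floquet eigenvalues will turn out to be real for
  this reason.\<close>

lemma selfadjoint_nonreal_bounded_below:
  assumes T: "bounded_op T" "selfadjoint_op T" and z: "Im z \<noteq> 0"
  shows "bounded_below_op T z"
proof -
  note TD = bounded_op_D[OF T(1)]
  have "\<bar>Im z\<bar> * ell2_norm \<psi> \<le> ell2_norm (\<lambda>n. T \<psi> n - z * \<psi> n)" if \<psi>: "\<psi> \<in> ell2" for \<psi>
  proof -
    define B where "B = (\<lambda>n. T \<psi> n - of_real (Re z) * \<psi> n)"
    define J where "J = (\<lambda>n. \<i> * of_real (Im z) * \<psi> n)"
    have BJ: "B \<in> ell2" "J \<in> ell2"
      using \<psi> TD by (simp_all add: B_def J_def)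
    have "ell2_inner (T \<psi>) \<psi> = ell2_inner \<psi> (T \<psi>)"
      using T(2) \<psi> by (simp add: selfadjoint_op_def)
    then have "Im (ell2_inner \<psi> (T \<psi>)) = 0"
      using ell2_inner_commute[of "T \<psi>" \<psi>] by (simp add: complex_eq_iff)
    moreover have "ell2_inner \<psi> B = ell2_inner \<psi> (T \<psi>) + ell2_inner \<psi> (\<lambda>n. - of_real (Re z) * \<psi> n)"
    proof -
      have "ell2_inner B \<psi> = ell2_inner (\<lambda>n. T \<psi> n + (- of_real (Re z)) * \<psi> n) \<psi>"
        by (simp add: B_def)
      also have "\<dots> = ell2_inner (T \<psi>) \<psi> + ell2_inner (\<lambda>n. (- of_real (Re z)) * \<psi> n) \<psi>"
        using \<psi> TD by (intro ell2_inner_add ell2_scale)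
      finally show ?thesis
        by (subst (1 2 3) ell2_inner_commute) simp
    qed
    ultimately have "Im (ell2_inner \<psi> B) = 0"
      using \<psi> by (simp only: ell2_inner_scale_right ell2_inner_self) simp
    then have "Im (ell2_inner B \<psi>) = 0"
      by (subst ell2_inner_commute) simp
    then have "inner (l2_of B) (l2_of J) = 0"
      using BJ by (simp add: inner_l2.rep_eq l2_of_inverse J_def ell2_inner_scale_right)
    then have "(norm (l2_of B - l2_of J))\<^sup>2 = (norm (l2_of B))\<^sup>2 + (norm (l2_of J))\<^sup>2"
      by (simp add: power2_norm_diff)
    then have "(norm (l2_of J))\<^sup>2 \<le> (norm (l2_of B - l2_of J))\<^sup>2"
      by simp
    then have "norm (l2_of J) \<le> norm (l2_of B - l2_of J)"
      by (rule power2_le_imp_le) simp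
    moreover have "l2_apply (l2_of B - l2_of J) = (\<lambda>n. T \<psi> n - z * \<psi> n)"
      using BJ unfolding minus_l2.rep_eq
      by (simp add: l2_of_inverse B_def J_def complex_eq_iff fun_eq_iff algebra_simps)
    ultimately have "ell2_norm J \<le> ell2_norm (\<lambda>n. T \<psi> n - z * \<psi> n)"
      using BJ by (simp add: norm_l2.rep_eq l2_of_inverse)
    then show ?thesis
      by (simp add: J_def ell2_norm_scale norm_mult)
  qed
  then show ?thesis
    unfolding bounded_below_op_def using z by (intro exI[of _ "\<bar>Im z\<bar>"]) auto
qed

section \<open>Reduction of lower bounds to finitely supported functions\<close>

lemma ell2_norm_finite_support:
  assumes "finite F" "\<And>n. n \<notin> F \<Longrightarrow> \<psi> n = 0"
  shows "(ell2_norm \<psi>)\<^sup>2 = (\<Sum>n\<in>F. (cmod (\<psi> n))\<^sup>2)"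
proof -
  have "(\<Sum>\<^sub>\<infinity>n. (cmod (\<psi> n))\<^sup>2) = (\<Sum>\<^sub>\<infinity>n\<in>F. (cmod (\<psi> n))\<^sup>2)"
    by (rule infsum_cong_neutral) (use assms in auto)
  then show ?thesis
    by (simp add: ell2_norm_power2 assms(1))
qed

lemma ell2_finite_support_dense:
  assumes \<psi>: "\<psi> \<in> ell2" and e: "e > 0"
  obtains \<phi> where "finite {n. \<phi> n \<noteq> 0}" "ell2_norm (\<lambda>n. \<psi> n - \<phi> n) \<le> e"
proof -
  let ?f = "\<lambda>n. (cmod (\<psi> n))\<^sup>2"
  have s: "?f summable_on UNIV" using \<psi> by (simp add: ell2_def)
  obtain F where F: "finite F" "dist (sum ?f F) (infsum ?f UNIV) \<le> e\<^sup>2"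
    using infsum_finite_approximation[OF s, of "e\<^sup>2"] e by auto
  define \<phi> where "\<phi> n = (if n \<in> F then \<psi> n else 0)" for n
  have "ell2_norm (\<lambda>n. \<psi> n - \<phi> n) \<le> e"
  proof (rule ell2_normI(2))
    fix G :: "'a set" assume G: "finite G"
    have "(\<Sum>n\<in>G. (cmod (\<psi> n - \<phi> n))\<^sup>2) = sum ?f (G - F)"
      using G by (intro sum.mono_neutral_cong_right) (auto simp: \<phi>_def)
    also have "\<dots> = sum ?f (F \<union> (G - F)) - sum ?f F"
      using F G by (subst sum.union_disjoint) auto
    also have "sum ?f (F \<union> (G - F)) \<le> infsum ?f UNIV"
      using F G by (intro finite_sum_le_infsum s) auto
    finally show "(\<Sum>n\<in>G. (cmod (\<psi> n - \<phi> n))\<^sup>2) \<le> e\<^sup>2"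
      using F(2) by (simp add: dist_real_def)
  qed (use e in simp)
  moreover have "finite {n. \<phi> n \<noteq> 0}"
    by (rule finite_subset[OF _ F(1)]) (auto simp: \<phi>_def)
  ultimately show ?thesis using that by blast
qed

text \<open>Both sides of the inequality are continuous in the norm because \<open>T - z\<close> is
  bounded, and finitely supported functions are dense.\<close>

lemma bounded_below_op_finite_support:
  assumes T: "bounded_op T" and c: "c > 0"
    and fin: "\<And>\<psi>. finite {n. \<psi> n \<noteq> 0} \<Longrightarrow> c * ell2_norm \<psi> \<le> ell2_norm (\<lambda>n. T \<psi> n - z * \<psi> n)"
  shows "bounded_below_op T z"
proof -
  define B where "B = (\<lambda>\<psi> n. T \<psi> n - z * \<psi> n)"
  have B: "bounded_op B"
    unfolding B_def by (rule bounded_op_shift[OF T])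
  note BD = bounded_op_D[OF B]
  obtain C where C: "C > 0" "\<And>\<psi>. \<psi> \<in> ell2 \<Longrightarrow> ell2_norm (B \<psi>) \<le> C * ell2_norm \<psi>"
    using bounded_op_norm[OF B] by blast
  have "c * ell2_norm \<psi> \<le> ell2_norm (B \<psi>)" if \<psi>: "\<psi> \<in> ell2" for \<psi>
  proof (rule field_le_epsilon)
    fix e :: real assume e: "e > 0"
    \<comment> \<open>Replacing \<open>\<psi>\<close> by \<open>\<phi>\<close> costs
      \<open>c * d\<close> on the left and \<open>C * d\<close> on the right, together
      \<open>e\<close>.\<close>
    define d where "d = e / (c + C)"
    have d: "d > 0" "(c + C) * d = e" using e c C by (auto simp: d_def)
    obtain \<phi> where \<phi>: "finite {n. \<phi> n \<noteq> 0}" "ell2_norm (\<lambda>n. \<psi> n - \<phi> n) \<le> d"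
      using ell2_finite_support_dense[OF \<psi> d(1)] by blast
    have \<phi>2: "\<phi> \<in> ell2" by (rule ell2_finite_support) fact
    define \<eta> where "\<eta> = (\<lambda>n. \<psi> n - \<phi> n)"
    have \<eta>: "\<eta> \<in> ell2" "ell2_norm \<eta> \<le> d" using \<psi> \<phi>2 \<phi>(2) by (auto simp: \<eta>_def)
    have "ell2_norm \<psi> = ell2_norm (\<lambda>n. \<phi> n + \<eta> n)" by (simp add: \<eta>_def)
    also have "\<dots> \<le> ell2_norm \<phi> + d" using ell2_norm_add[OF \<phi>2 \<eta>(1)] \<eta>(2) by simp
    finally have "c * ell2_norm \<psi> \<le> c * ell2_norm \<phi> + c * d"
      using c by (metis distrib_left mult_left_mono less_eq_real_def)
    also have "c * ell2_norm \<phi> \<le> ell2_norm (B \<phi>)"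
      using fin[OF \<phi>(1)] by (simp add: B_def)
    also have "B \<phi> = B (\<lambda>n. \<psi> n + (- 1) * \<eta> n)"
      by (simp add: \<eta>_def)
    also have "\<dots> = (\<lambda>n. B \<psi> n + (- 1) * B \<eta> n)"
      using \<psi> \<eta>(1) by (subst BD(2)) (simp_all only: BD(3) ell2_scale)
    also have "ell2_norm \<dots> \<le> ell2_norm (B \<psi>) + ell2_norm (\<lambda>n. (- 1) * B \<eta> n)"
      using \<psi> \<eta>(1) by (intro ell2_norm_add ell2_scale BD)
    also have "ell2_norm (\<lambda>n. (- 1) * B \<eta> n) \<le> C * d"
      using order_trans[OF C(2)[OF \<eta>(1)] mult_left_mono[OF \<eta>(2), of C]] C(1)
      by (simp only: ell2_norm_scale) simp
    finally show "c * ell2_norm \<psi> \<le> ell2_norm (B \<psi>) + e"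
      using d(2) by (simp add: distrib_right)
  qed
  then show ?thesis
    unfolding bounded_below_op_def B_def using c by blast
qed

section \<open>Bloch solutions lie in the spectrum\<close>

lemma dist1_commute: "dist1 m n = dist1 n m"
  by (simp add: dist1_def abs_minus_commute)

lemma dist1_triangle: "dist1 m k \<le> dist1 m n + dist1 n k"
  unfolding dist1_def sum.distrib[symmetric] by (intro sum_mono) simp

lemma dist1_translate: "dist1 (\<lambda>j. m j + a j) (\<lambda>j. n j + a j) = dist1 m n"
  by (simp add: dist1_def)

lemma sum_neighbours_translate:
  "(\<Sum>m | dist1 m (\<lambda>j. n j + a j) = 1. f m) = (\<Sum>m | dist1 m n = 1. f (\<lambda>j. m j + a j))"
proof (rule sum.reindex_bij_witness[where i = "\<lambda>m j. m j + a j" and j = "\<lambda>m j. m j - a j"])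
  fix m assume "m \<in> {m. dist1 m (\<lambda>j. n j + a j) = 1}"
  then show "(\<lambda>j. m j - a j) \<in> {m. dist1 m n = 1}"
    using dist1_translate[of "\<lambda>j. m j - a j" a n] by simp
qed (simp_all add: dist1_translate)

lemma sum_power_abs_le:
  fixes r :: real
  assumes r: "0 \<le> r" "r < 1"
  shows "(\<Sum>k\<in>{- int M..int M}. r ^ nat \<bar>k\<bar>) \<le> 2 / (1 - r)"
proof -
  have "(\<Sum>i\<le>M. r ^ i) \<le> 1 / (1 - r)"
    using sum_le_suminf[OF summable_geometric, of r "{..M}"] suminf_geometric[of r] r by simp
  moreover have "(\<Sum>k\<in>{- int M..int M}. r ^ nat \<bar>k\<bar>) \<le>
      (\<Sum>k\<in>int ` {..M}. r ^ nat \<bar>k\<bar>) + (\<Sum>k\<in>(\<lambda>i. - int i) ` {..M}. r ^ nat \<bar>k\<bar>)"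
  proof -
    have "k \<in> int ` {..M} \<union> (\<lambda>i. - int i) ` {..M}" if "k \<in> {- int M..int M}" for k
    proof (cases "k \<ge> 0")
      case True
      with that have "k = int (nat k)" "nat k \<in> {..M}" by auto
      then show ?thesis by blast
    next
      case False
      with that have "k = - int (nat (- k))" "nat (- k) \<in> {..M}" by auto
      then show ?thesis by blast
    qed
    then have sub: "{- int M..int M} \<subseteq> int ` {..M} \<union> (\<lambda>i. - int i) ` {..M}" by blast
    have "(\<Sum>k\<in>{- int M..int M}. r ^ nat \<bar>k\<bar>) \<le> (\<Sum>k\<in>int ` {..M} \<union> (\<lambda>i. - int i) ` {..M}. r ^ nat \<bar>k\<bar>)"
      using r by (intro sum_mono2[OF _ sub]) auto
    also have "\<dots> \<le> (\<Sum>k\<in>int ` {..M}. r ^ nat \<bar>k\<bar>) + (\<Sum>k\<in>(\<lambda>i. - int i) ` {..M}. r ^ nat \<bar>k\<bar>)"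
      using r by (subst sum_Un) (auto intro!: sum_nonneg)
    finally show ?thesis .
  qed
  moreover have "(\<Sum>k\<in>int ` {..M}. r ^ nat \<bar>k\<bar>) = (\<Sum>i\<le>M. r ^ i)"
    by (subst sum.reindex) (auto simp: inj_on_def)
  moreover have "(\<Sum>k\<in>(\<lambda>i. - int i) ` {..M}. r ^ nat \<bar>k\<bar>) = (\<Sum>i\<le>M. r ^ i)"
    by (subst sum.reindex) (auto simp: inj_on_def)
  ultimately show ?thesis by simp
qed

text \<open>The weight is defined with the 1-norm, so its square is a product over the coordinates,
  and the sum over a box factors into two-sided geometric sums bounded independently of the
  box.\<close>

lemma exp_decay_in_ell2:
  assumes e: "e > 0"
  shows "(\<lambda>n::'d::finite \<Rightarrow> int. complex_of_real (exp (- e * real_of_int (dist1 n (\<lambda>j. 0))))) \<in> ell2"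
proof (rule ell2_normI)
  define r where "r = exp (- 2 * e)"
  have r: "0 \<le> r" "r < 1" using e by (auto simp: r_def)
  define R where "R = (\<Prod>j\<in>(UNIV::'d set). 2 / (1 - r))"
  have R0: "0 \<le> R" unfolding R_def using r by (intro prod_nonneg) auto
  then show "0 \<le> sqrt R" by simp
  fix F :: "('d \<Rightarrow> int) set" assume F: "finite F"
  let ?f = "\<lambda>n::'d \<Rightarrow> int. (cmod (complex_of_real (exp (- e * real_of_int (dist1 n (\<lambda>j. 0))))))\<^sup>2"
  have f: "?f n = (\<Prod>j\<in>UNIV. r ^ nat \<bar>n j\<bar>)" for n
  proof -
    have "?f n = exp (- 2 * e * real_of_int (dist1 n (\<lambda>j. 0)))"
      by (simp add: exp_double[symmetric])
    also have "\<dots> = exp (\<Sum>j\<in>UNIV. - 2 * e * \<bar>real_of_int (n j)\<bar>)"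
      by (simp add: dist1_def sum_distrib_left)
    also have "\<dots> = (\<Prod>j\<in>UNIV. exp (- 2 * e * \<bar>real_of_int (n j)\<bar>))"
      by (rule exp_sum) simp
    also have "\<dots> = (\<Prod>j\<in>UNIV. r ^ nat \<bar>n j\<bar>)"
      by (intro prod.cong refl) (simp add: r_def exp_of_nat_mult[symmetric] mult.commute)
    finally show ?thesis .
  qed
  define M where "M = nat (\<Sum>n\<in>F. \<Sum>j\<in>UNIV. \<bar>n j\<bar>)"
  have "F \<subseteq> (\<Pi>\<^sub>E j\<in>UNIV. {- int M..int M})"
  proof
    fix n assume n: "n \<in> F"
    have "- int M \<le> n j \<and> n j \<le> int M" for j
    proof -
      have "\<bar>n j\<bar> \<le> (\<Sum>j\<in>UNIV. \<bar>n j\<bar>)" by (rule member_le_sum) auto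
      also have "\<dots> \<le> (\<Sum>n\<in>F. \<Sum>j\<in>UNIV. \<bar>n j\<bar>)"
        using n F by (intro member_le_sum sum_nonneg) auto
      also have "\<dots> = int M" by (simp add: M_def sum_nonneg)
      finally show ?thesis by linarith
    qed
    then show "n \<in> (\<Pi>\<^sub>E j\<in>UNIV. {- int M..int M})"
      by (simp add: PiE_iff)
  qed
  then have "sum ?f F \<le> sum ?f (\<Pi>\<^sub>E j\<in>UNIV. {- int M..int M})"
    by (intro sum_mono2 finite_PiE) auto
  also have "\<dots> = (\<Prod>j\<in>(UNIV::'d set). \<Sum>k\<in>{- int M..int M}. r ^ nat \<bar>k\<bar>)"
    unfolding f by (rule prod_sum_PiE[symmetric]) auto
  also have "\<dots> \<le> R"
    unfolding R_def by (intro prod_mono conjI sum_power_abs_le sum_nonneg) (use r in auto)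
  finally show "sum ?f F \<le> (sqrt R)\<^sup>2"
    using R0 by simp
qed

lemma finite_cell: "finite (cell p)"
  using bij_betw_finite[OF cell_enum_bij, of p] by simp

text \<open>The Bloch multipliers have modulus 1, so the finitely many values on the cell bound all
  others. The summand 1 keeps the bound positive even if \<open>u\<close> vanishes.\<close>

lemma floquet_space_bounded:
  assumes p: "\<forall>j. 0 < (p :: 'd::finite \<Rightarrow> nat) j" and u: "u \<in> floquet_space p \<theta>"
  shows "\<exists>K>0. \<forall>n. cmod (u n) \<le> K"
proof -
  have "cmod (u n) \<le> (\<Sum>m\<in>cell p. cmod (u m)) + 1" for n
  proof -
    let ?m = "\<lambda>j. n j mod int (p j)"
    have "cmod (u n) = cmod (floquet_ext p \<theta> u n)"
      using floquet_space_eq_ext[OF u] by simp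
    then have "cmod (u n) = cmod (u ?m)"
      by (simp add: floquet_ext_def norm_mult)
    moreover have "?m \<in> cell p"
      using p by (simp add: cell_def)
    then have "cmod (u ?m) \<le> (\<Sum>m\<in>cell p. cmod (u m))"
      by (intro member_le_sum finite_cell) auto
    ultimately show ?thesis by simp
  qed
  moreover have "(\<Sum>m\<in>cell p. cmod (u m)) + 1 > 0"
    by (intro add_nonneg_pos sum_nonneg) auto
  ultimately show ?thesis by blast
qed

lemma schrodinger_delta:
  "schrodinger V (\<lambda>m. if m = n then 1 else 0) n = of_real (V n)"
proof -
  have "(\<Sum>m | dist1 m n = 1. if m = n then 1 else (0::complex)) = 0"
    by (intro sum.neutral) (auto simp: dist1_def)
  then show ?thesis by (simp add: schrodinger_def)
qed

text \<open>Evaluated at its own site, a point mass sees no hopping, since no site is its own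
  neighbour. The bound will be used to separate the hopping term from the operator.\<close>

lemma bounded_potential:
  assumes "bounded_op (schrodinger V)"
    and C: "\<And>\<psi>. \<psi> \<in> ell2 \<Longrightarrow> ell2_norm (schrodinger V \<psi>) \<le> C * ell2_norm \<psi>"
  shows "\<bar>V n\<bar> \<le> C"
proof -
  let ?d = "\<lambda>m. if m = n then 1 else (0::complex)"
  have d: "?d \<in> ell2" by (rule ell2_finite_support) simp
  have "(ell2_norm ?d)\<^sup>2 = 1"
    by (subst ell2_norm_finite_support[of "{n}"]) auto
  then have "ell2_norm ?d = 1"
    by (simp add: power2_eq_1_iff) (metis ell2_norm_nonneg neg_0_le_iff_le not_one_le_zero)
  moreover have "cmod (schrodinger V ?d n) \<le> ell2_norm (schrodinger V ?d)"
    by (intro cmod_le_ell2_norm bounded_op_D[OF assms(1)] d)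
  ultimately show ?thesis
    using C[OF d] by (simp add: schrodinger_delta)
qed

text \<open>
  The weight \<open>w = exp (- e |n|)\<close> varies by a factor close to 1 between neighbours, so that the
  commutator of \<open>w\<close> with the operator is small compared to \<open>w u\<close>.
\<close>

lemma bloch_solution_not_bounded_below:
  fixes V :: "('d::finite \<Rightarrow> int) \<Rightarrow> real"
  assumes T: "bounded_op (schrodinger V)" and p: "\<forall>j. 0 < p j"
    and u: "u \<in> floquet_space p \<theta>" "u \<noteq> (\<lambda>n. 0)" "\<And>n. schrodinger V u n = z * u n"
  shows "\<not> bounded_below_op (schrodinger V) z"
proof
  assume "bounded_below_op (schrodinger V) z"
  then obtain c where c: "c > 0"
    "\<And>\<psi>. \<psi> \<in> ell2 \<Longrightarrow> c * ell2_norm \<psi> \<le> ell2_norm (\<lambda>n. schrodinger V \<psi> n - z * \<psi> n)"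
    unfolding bounded_below_op_def by blast
  note TD = bounded_op_D[OF T]
  obtain C where C: "C > 0" "\<And>\<psi>. \<psi> \<in> ell2 \<Longrightarrow> ell2_norm (schrodinger V \<psi>) \<le> C * ell2_norm \<psi>"
    using bounded_op_norm[OF T] by blast
  obtain K where K: "K > 0" "\<And>n. cmod (u n) \<le> K"
    using floquet_space_bounded[OF p u(1)] by blast
  \<comment> \<open>The hopping term has norm at most \<open>2 * C\<close>, one \<open>C\<close> for
    the operator and one for the potential. With \<open>exp e - 1 = c / (4 * C)\<close> the error is
    at most \<open>c / 2\<close> times the norm of the damped solution, which contradicts the lower
    bound \<open>c\<close>.\<close>
  define e where "e = ln (1 + c / (4 * C))"
  have "c / (4 * C) > 0" using c(1) C(1) by simp
  then have e: "e > 0" "exp e = 1 + c / (4 * C)"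
    by (simp_all add: e_def ln_gt_zero del: zero_less_divide_iff)
  define w where "w n = exp (- e * real_of_int (dist1 n (\<lambda>j. 0)))" for n :: "'d \<Rightarrow> int"
  have w: "w n > 0" for n by (simp add: w_def)
  \<comment> \<open>The variation is measured by the weight at the neighbour \<open>m\<close>, not
    at \<open>n\<close>, so that the values \<open>\<psi> m\<close> themselves appear when the
    estimate is summed over \<open>m\<close>.\<close>
  have w_step: "\<bar>w m - w n\<bar> \<le> (exp e - 1) * w m" if "dist1 m n = 1" for m n
  proof -
    have le: "w a \<le> exp e * w b" if "dist1 a b = 1" for a b
    proof -
      have "dist1 b (\<lambda>j. 0) \<le> 1 + dist1 a (\<lambda>j. 0)"
        using dist1_triangle[of b "\<lambda>j. 0" a] that by (simp add: dist1_commute)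
      then have "real_of_int (dist1 b (\<lambda>j. 0)) \<le> 1 + real_of_int (dist1 a (\<lambda>j. 0))"
        by linarith
      then have "e * real_of_int (dist1 b (\<lambda>j. 0)) \<le> e * (1 + real_of_int (dist1 a (\<lambda>j. 0)))"
        using e(1) by (intro mult_left_mono) auto
      then show ?thesis
        unfolding w_def exp_add[symmetric] by (simp add: algebra_simps)
    qed
    have 1: "w n \<le> exp e * w m" using le[of n m] that by (simp add: dist1_commute)
    have "w m \<le> exp e * w n" using le[OF that] .
    then have "exp (- e) * w m \<le> exp (- e) * (exp e * w n)" by (intro mult_left_mono) auto
    also have "\<dots> = w n" by (simp add: exp_minus)
    finally have "w m - w n \<le> (1 - exp (- e)) * w m" by (simp add: left_diff_distrib)
    also have "\<dots> \<le> (exp e - 1) * w m"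
      using w[of m] exp_ge_add_one_self[of e] exp_ge_add_one_self[of "- e"]
      by (intro mult_right_mono) linarith+
    finally show ?thesis using 1 by (simp add: left_diff_distrib abs_le_iff)
  qed
  define \<psi> where "\<psi> n = of_real (w n) * u n" for n
  have \<psi>: "\<psi> \<in> ell2"
  proof (rule ell2_comparison)
    show "(\<lambda>n. of_real K * complex_of_real (w n)) \<in> ell2"
      unfolding w_def by (intro ell2_scale exp_decay_in_ell2 e)
    show "cmod (\<psi> n) \<le> cmod (of_real K * complex_of_real (w n))" for n
      using K w[of n] by (simp add: \<psi>_def norm_mult mult.commute[of K] mult_left_mono)
  qed
  \<comment> \<open>The commutator is estimated by absolute values. Its majorant is the hopping term
    applied to \<open>\<phi>\<close>, which has the same norm as \<open>\<psi>\<close>.\<close>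
  define \<phi> where "\<phi> n = complex_of_real (cmod (\<psi> n))" for n
  have \<phi>: "\<phi> \<in> ell2" by (rule ell2_comparison[OF \<psi>]) (simp add: \<phi>_def)
  have \<phi>\<psi>: "ell2_norm \<phi> = ell2_norm \<psi>" by (simp add: ell2_norm_def \<phi>_def)
  define A where "A n = (\<Sum>m | dist1 m n = 1. \<phi> m)" for n
  define U where "U n = - of_real (V n) * \<phi> n" for n
  have U_le: "cmod (U n) \<le> cmod (of_real C * \<phi> n)" for n
    using bounded_potential[OF T C(2), of n] C(1)
    by (simp add: U_def norm_mult mult_right_mono)
  have U: "U \<in> ell2" by (rule ell2_comparison[OF ell2_scale[OF \<phi>] U_le])
  have A_eq: "A = (\<lambda>n. schrodinger V \<phi> n + U n)"
    by (simp add: A_def U_def schrodinger_def fun_eq_iff)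
  have A: "A \<in> ell2" unfolding A_eq by (intro ell2_add TD \<phi> U)
  have "ell2_norm U \<le> ell2_norm (\<lambda>n. of_real C * \<phi> n)"
    by (rule ell2_norm_mono[OF ell2_scale[OF \<phi>] U_le])
  then have "ell2_norm U \<le> C * ell2_norm \<psi>"
    using C(1) by (simp add: ell2_norm_scale \<phi>\<psi>)
  then have A_norm: "ell2_norm A \<le> 2 * C * ell2_norm \<psi>"
    using ell2_norm_add[OF TD(1)[OF \<phi>] U] C(2)[OF \<phi>] unfolding A_eq \<phi>\<psi> by simp
  have pw: "cmod (schrodinger V \<psi> n - z * \<psi> n) \<le> cmod (of_real (exp e - 1) * A n)" for n
  proof -
    have "z * \<psi> n = of_real (w n) * schrodinger V u n"
      by (simp add: \<psi>_def u(3))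
    then have "schrodinger V \<psi> n - z * \<psi> n =
        (\<Sum>m | dist1 m n = 1. \<psi> m) - of_real (w n) * (\<Sum>m | dist1 m n = 1. u m)"
      by (simp add: schrodinger_def \<psi>_def algebra_simps)
    also have "\<dots> = (\<Sum>m | dist1 m n = 1. of_real (w m - w n) * u m)"
      by (simp add: sum_distrib_left sum_subtractf \<psi>_def left_diff_distrib)
    also have "cmod \<dots> \<le> (\<Sum>m | dist1 m n = 1. cmod (of_real (w m - w n) * u m))"
      by (rule norm_sum)
    also have "\<dots> \<le> (\<Sum>m | dist1 m n = 1. (exp e - 1) * cmod (\<psi> m))"
    proof (rule sum_mono)
      fix m assume "m \<in> {m. dist1 m n = 1}"
      then have "\<bar>w m - w n\<bar> * cmod (u m) \<le> (exp e - 1) * w m * cmod (u m)"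
        by (intro mult_right_mono w_step) auto
      then show "cmod (of_real (w m - w n) * u m) \<le> (exp e - 1) * cmod (\<psi> m)"
        using w[of m] unfolding \<psi>_def norm_mult norm_of_real by (simp add: mult.assoc)
    qed
    also have "\<dots> = cmod (of_real (exp e - 1) * A n)"
    proof -
      have "A n = of_real (\<Sum>m | dist1 m n = 1. cmod (\<psi> m))"
        by (simp add: A_def \<phi>_def)
      then have "cmod (A n) = (\<Sum>m | dist1 m n = 1. cmod (\<psi> m))"
        by (simp only: norm_of_real) (simp add: sum_nonneg)
      then show ?thesis
        using e(1) unfolding norm_mult norm_of_real by (simp add: sum_distrib_left)
    qed
    finally show ?thesis .
  qed
  have "c * ell2_norm \<psi> \<le> ell2_norm (\<lambda>n. schrodinger V \<psi> n - z * \<psi> n)"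
    by (rule c(2)[OF \<psi>])
  also have "\<dots> \<le> ell2_norm (\<lambda>n. of_real (exp e - 1) * A n)"
    by (rule ell2_norm_mono[OF ell2_scale[OF A] pw])
  also have "\<dots> = (c / (4 * C)) * ell2_norm A"
    using c(1) C(1) unfolding ell2_norm_scale norm_of_real e(2) by simp
  also have "\<dots> \<le> (c / (4 * C)) * (2 * C * ell2_norm \<psi>)"
    using c(1) C(1) by (intro mult_left_mono A_norm) auto
  also have "\<dots> = c / 2 * ell2_norm \<psi>"
    using C(1) by simp
  finally have "ell2_norm \<psi> \<le> 0"
    using c(1) by (simp add: mult_le_0_iff)
  then have "\<psi> = (\<lambda>n. 0)"
    using ell2_norm_eq_0_iff[OF \<psi>] by (simp add: antisym)
  then have "of_real (w n) * u n = 0" for n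
    by (metis \<psi>_def)
  then have "u n = 0" for n
    using w[of n] by (metis less_irrefl mult_eq_0_iff of_real_eq_0_iff)
  then show False using u(2) by auto
qed

text \<open>\<open>z\<close> starts out complex because it will be a root of a characteristic
  polynomial; its reality is part of the conclusion.\<close>

lemma bloch_solution_in_spec:
  fixes V :: "('d::finite \<Rightarrow> int) \<Rightarrow> real"
  assumes T: "bounded_op (schrodinger V)" "selfadjoint_op (schrodinger V)" and p: "\<forall>j. 0 < p j"
    and u: "u \<in> floquet_space p \<theta>" "u \<noteq> (\<lambda>n. 0)" "\<And>n. schrodinger V u n = z * u n"
  shows "Im z = 0" "Re z \<in> spec (schrodinger V)"
proof -
  have nb: "\<not> bounded_below_op (schrodinger V) z"
    by (rule bloch_solution_not_bounded_below[OF T(1) p u])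
  then show "Im z = 0"
    using selfadjoint_nonreal_bounded_below[OF T] by blast
  then have "z = of_real (Re z)"
    by (simp add: complex_eq_iff)
  then show "Re z \<in> spec (schrodinger V)"
    using nb not_in_spec_iff[OF T, of "Re z"] by metis
qed

section \<open>Points of the spectrum have Bloch solutions\<close>

text \<open>As a function of \<open>n\<close>, this is the Bloch-Floquet transform of the point mass
  at \<open>m\<close>: the point mass is copied along the period lattice with phases that make it
  quasi-periodic. The phase depends on \<open>n - m\<close> only and not on representatives in the
  cell, whence the invariance under simultaneous translation.\<close>

definition bloch_kernel ::
  "('d::finite \<Rightarrow> nat) \<Rightarrow> ('d \<Rightarrow> real) \<Rightarrow> ('d \<Rightarrow> int) \<Rightarrow> ('d \<Rightarrow> int) \<Rightarrow> complex" where
  "bloch_kernel p \<theta> m n =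
     (if \<forall>j. int (p j) dvd m j - n j then cis (2 * pi * (\<Sum>j\<in>UNIV. \<theta> j * real_of_int (n j - m j))) else 0)"

definition bloch_sum ::
  "('d::finite \<Rightarrow> int) set \<Rightarrow> ('d \<Rightarrow> nat) \<Rightarrow> ('d \<Rightarrow> real) \<Rightarrow> (('d \<Rightarrow> int) \<Rightarrow> complex) \<Rightarrow> ('d \<Rightarrow> int) \<Rightarrow> complex" where
  "bloch_sum F p \<theta> \<psi> n = (\<Sum>m\<in>F. bloch_kernel p \<theta> m n * \<psi> m)"

lemma bloch_kernel_translate:
  "bloch_kernel p \<theta> (\<lambda>j. m j + a j) (\<lambda>j. n j + a j) = bloch_kernel p \<theta> m n"
  by (simp add: bloch_kernel_def)

lemma bloch_kernel_in_floquet_space: "bloch_kernel p \<theta> m \<in> floquet_space p (\<theta> :: 'd::finite \<Rightarrow> real)"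
proof -
  have "bloch_kernel p \<theta> m (n(j := n j + int (p j))) =
      cis (2 * pi * real (p j) * \<theta> j) * bloch_kernel p \<theta> m n" for n j
  proof -
    let ?n = "n(j := n j + int (p j))"
    have d: "(\<forall>i. int (p i) dvd m i - ?n i) \<longleftrightarrow> (\<forall>i. int (p i) dvd m i - n i)"
    proof (intro all_cong1)
      fix i
      have "m i - ?n i = m i - n i + int (p i) * (if i = j then - 1 else 0)" by simp
      then show "int (p i) dvd m i - ?n i \<longleftrightarrow> int (p i) dvd m i - n i"
        by (metis dvd_add_times_triv_right_iff mult.commute)
    qed
    have "(\<Sum>i\<in>UNIV. \<theta> i * real_of_int (?n i - m i)) =
        (\<Sum>i\<in>UNIV. \<theta> i * real_of_int (n i - m i) + (if i = j then real (p j) * \<theta> j else 0))"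
      by (intro sum.cong) (auto simp: algebra_simps)
    also have "\<dots> = (\<Sum>i\<in>UNIV. \<theta> i * real_of_int (n i - m i)) + real (p j) * \<theta> j"
      by (simp add: sum.distrib)
    finally show ?thesis
      unfolding bloch_kernel_def d by (simp add: cis_mult distrib_left add.commute mult.assoc)
  qed
  then show ?thesis
    by (simp add: floquet_space_def)
qed

lemma floquet_space_sum:
  assumes "\<And>m. m \<in> F \<Longrightarrow> f m \<in> floquet_space p \<theta>"
  shows "(\<lambda>n. \<Sum>m\<in>F. f m n * c m) \<in> floquet_space p \<theta>"
  using assms unfolding floquet_space_def by (auto simp: sum_distrib_left mult.assoc)

lemma bloch_sum_in_floquet_space: "bloch_sum F p \<theta> \<psi> \<in> floquet_space p \<theta>"
  unfolding bloch_sum_def by (intro floquet_space_sum bloch_kernel_in_floquet_space)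

text \<open>A periodic function belongs to the Floquet space of quasimomentum 0, so
  \<open>floquet_space_eq_ext\<close> determines both values by the common residue in the
  cell.\<close>

lemma periodic_potential_cong:
  assumes V: "periodic_potential p V" and d: "\<forall>j. int (p j) dvd m j - n j"
  shows "V m = V n"
proof -
  let ?V = "\<lambda>n. complex_of_real (V n)"
  have V0: "?V \<in> floquet_space p (\<lambda>j. 0)"
    using V by (simp add: floquet_space_def periodic_potential_def)
  have r: "?V m = ?V (\<lambda>j. m j mod int (p j))" for m
    using fun_cong[OF floquet_space_eq_ext[OF V0], of m] by (simp add: floquet_ext_def)
  have "m j mod int (p j) = n j mod int (p j)" for j
    using d by (simp add: mod_eq_dvd_iff)
  then have "?V m = ?V n"
    using r[of m] r[of n] by simp
  then show ?thesis by simp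
qed

text \<open>The operator moves from the variable \<open>n\<close> to the source \<open>a\<close>.
  Replacing \<open>m\<close> by \<open>n + a - m\<close> exchanges the neighbours of the two points
  and preserves the difference on which the kernel depends; the potentials agree wherever the kernel
  does not vanish.\<close>

lemma schrodinger_bloch_kernel:
  assumes V: "periodic_potential p V"
  shows "schrodinger V (bloch_kernel p \<theta> a) n =
    (\<Sum>m | dist1 m a = 1. bloch_kernel p \<theta> m n) + of_real (V a) * bloch_kernel p \<theta> a n"
proof -
  have "(\<Sum>m | dist1 m n = 1. bloch_kernel p \<theta> a m) = (\<Sum>m | dist1 m a = 1. bloch_kernel p \<theta> m n)"
  proof (rule sum.reindex_bij_witness[where i = "\<lambda>m j. n j + a j - m j" and j = "\<lambda>m j. n j + a j - m j"])
    fix m assume "m \<in> {m. dist1 m n = 1}"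
    then show "(\<lambda>j. n j + a j - m j) \<in> {m. dist1 m a = 1}"
      by (simp add: dist1_def abs_minus_commute)
    have "bloch_kernel p \<theta> (\<lambda>j. (n j + a j - m j) + (m j - n j)) (\<lambda>j. n j + (m j - n j)) =
        bloch_kernel p \<theta> (\<lambda>j. n j + a j - m j) n"
      by (rule bloch_kernel_translate)
    then show "bloch_kernel p \<theta> (\<lambda>j. n j + a j - m j) n = bloch_kernel p \<theta> a m"
      by simp
  next
    fix m assume "m \<in> {m. dist1 m a = 1}"
    then show "(\<lambda>j. n j + a j - m j) \<in> {m. dist1 m n = 1}"
      by (simp add: dist1_def abs_minus_commute)
  qed auto
  moreover have "of_real (V n) * bloch_kernel p \<theta> a n = of_real (V a) * bloch_kernel p \<theta> a n"
    using periodic_potential_cong[OF V, of a n] by (auto simp: bloch_kernel_def)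
  ultimately show ?thesis
    by (simp add: schrodinger_def)
qed

text \<open>The transform intertwines the operator with its action on the Floquet space.
  \<open>F\<close> includes the neighbours of the support because it also has to carry
  \<open>schrodinger V \<psi>\<close>.\<close>

lemma schrodinger_bloch_sum:
  assumes V: "periodic_potential p V" and F: "finite F"
    and supp: "\<And>m a. \<psi> a \<noteq> 0 \<Longrightarrow> m = a \<or> dist1 m a = 1 \<Longrightarrow> m \<in> F"
  shows "schrodinger V (bloch_sum F p \<theta> \<psi>) n = bloch_sum F p \<theta> (schrodinger V \<psi>) n"
proof -
  let ?k = "bloch_kernel p \<theta>"
  have 1: "schrodinger V (bloch_sum F p \<theta> \<psi>) n = (\<Sum>a\<in>F. \<psi> a * schrodinger V (?k a) n)"
  proof -
    have "(\<Sum>m | dist1 m n = 1. \<Sum>a\<in>F. ?k a m * \<psi> a) = (\<Sum>a\<in>F. \<psi> a * (\<Sum>m | dist1 m n = 1. ?k a m))"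
      by (subst sum.swap) (simp add: sum_distrib_left mult.commute)
    then show ?thesis
      by (simp add: schrodinger_def bloch_sum_def distrib_left sum.distrib sum_distrib_left mult_ac)
  qed
  have 2: "(\<Sum>a\<in>F. \<psi> a * (\<Sum>m | dist1 m a = 1. ?k m n)) = (\<Sum>m\<in>F. ?k m n * (\<Sum>a | dist1 a m = 1. \<psi> a))"
  proof -
    have "(\<Sum>a\<in>F. \<psi> a * (\<Sum>m | dist1 m a = 1. ?k m n)) =
        (\<Sum>a\<in>F. \<Sum>m\<in>F. if dist1 m a = 1 then ?k m n * \<psi> a else 0)"
    proof (rule sum.cong[OF refl])
      fix a
      show "\<psi> a * (\<Sum>m | dist1 m a = 1. ?k m n) = (\<Sum>m\<in>F. if dist1 m a = 1 then ?k m n * \<psi> a else 0)"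
      proof (cases "\<psi> a = 0")
        case False
        then have "{m. dist1 m a = 1} \<subseteq> F" using supp by blast
        then have "{m \<in> F. dist1 m a = 1} = {m. dist1 m a = 1}" by blast
        then show ?thesis
          using F by (simp add: sum_distrib_left mult.commute flip: sum.inter_filter)
      qed (simp cong: if_cong)
    qed
    also have "\<dots> = (\<Sum>m\<in>F. \<Sum>a\<in>F. if dist1 m a = 1 then ?k m n * \<psi> a else 0)"
      by (rule sum.swap)
    also have "\<dots> = (\<Sum>m\<in>F. ?k m n * (\<Sum>a | dist1 a m = 1. \<psi> a))"
    proof (rule sum.cong[OF refl])
      fix m
      have "(\<Sum>a | dist1 a m = 1. \<psi> a) = (\<Sum>a\<in>{a \<in> F. dist1 a m = 1}. \<psi> a)"
        using supp by (intro sum.mono_neutral_right finite_neighbours) auto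
      then show "(\<Sum>a\<in>F. if dist1 m a = 1 then ?k m n * \<psi> a else 0) = ?k m n * (\<Sum>a | dist1 a m = 1. \<psi> a)"
        using F by (simp add: sum_distrib_left dist1_commute[of m] flip: sum.inter_filter)
    qed
    finally show ?thesis .
  qed
  show ?thesis
    unfolding 1 schrodinger_bloch_kernel[OF V] bloch_sum_def
    using 2 by (simp add: schrodinger_def distrib_left sum.distrib mult_ac)
qed

lemma bloch_sum_diff:
  "bloch_sum F p \<theta> (\<lambda>n. \<phi> n - c * \<psi> n) n = bloch_sum F p \<theta> \<phi> n - c * bloch_sum F p \<theta> \<psi> n"
  by (simp add: bloch_sum_def right_diff_distrib sum_subtractf sum_distrib_left mult_ac)

section \<open>Parseval's identity on a discrete torus\<close>

lemma cis_sum: "finite A \<Longrightarrow> cis (\<Sum>x\<in>A. f x) = (\<Prod>x\<in>A. cis (f x))"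
proof (induction A rule: finite_induct)
  case (insert x A)
  then show ?case by (metis cis_mult prod.insert sum.insert)
qed simp

text \<open>This is the geometric sum of an \<open>N\<close>-th root of unity, which is not 1
  because \<open>N\<close> does not divide \<open>k\<close>.\<close>

lemma sum_cis_int_multiple:
  assumes k: "\<bar>k\<bar> < int N" "k \<noteq> 0"
  shows "(\<Sum>l<N. cis (2 * pi * (real l * real_of_int k / real N))) = 0"
proof -
  define \<omega> where "\<omega> = cis (2 * pi * (real_of_int k / real N))"
  have N: "real N > 0" using k by simp
  have "\<omega> \<noteq> 1"
  proof
    assume "\<omega> = 1"
    then have "exp (\<i> * complex_of_real (2 * pi * (real_of_int k / real N))) = 1"
      by (simp add: \<omega>_def cis_conv_exp)
    then obtain i :: int where "2 * pi * (real_of_int k / real N) = of_int (2 * i) * pi"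
      unfolding exp_eq_1 by auto
    then have "real_of_int k = real_of_int (i * int N)"
      using N by (simp add: field_simps)
    then have "k = i * int N"
      using of_int_eq_iff by blast
    with k show False
      by (simp add: abs_mult)
  qed
  moreover have "\<omega> ^ N = 1"
  proof -
    have "\<omega> ^ N = cis (real N * (2 * pi * (real_of_int k / real N)))"
      by (simp only: \<omega>_def Complex.DeMoivre)
    also have "real N * (2 * pi * (real_of_int k / real N)) = 2 * pi * real_of_int k"
      using N by simp
    finally show ?thesis by simp
  qed
  ultimately have "(\<Sum>l<N. \<omega> ^ l) = 0"
    by (simp add: geometric_sum)
  moreover have "\<omega> ^ l = cis (2 * pi * (real l * real_of_int k / real N))" for l
    unfolding \<omega>_def Complex.DeMoivre by (rule arg_cong[where f = cis]) simp
  ultimately show ?thesis by simp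
qed

text \<open>The quasimomenta of the torus with \<open>N p\<^sub>j\<close> sites in direction \<open>j\<close>.\<close>

definition torus_momentum :: "nat \<Rightarrow> ('d \<Rightarrow> nat) \<Rightarrow> ('d \<Rightarrow> nat) \<Rightarrow> 'd \<Rightarrow> real" where
  "torus_momentum N p l j = real (l j) / (real N * real (p j))"

text \<open>Both kernels are nonzero only if \<open>m\<close> and \<open>m'\<close> are congruent to
  \<open>n\<close>. Then \<open>m' - m\<close> is \<open>p j * k j\<close> in each coordinate, the
  phases at the torus momenta combine to powers of \<open>N\<close>-th roots of unity, and the sum
  over \<open>l\<close> factors. The bound by \<open>N\<close> excludes aliasing, that is, a nonzero
  \<open>k j\<close> divisible by \<open>N\<close>.\<close>

lemma sum_bloch_kernel_orthogonal:
  fixes p :: "'d::finite \<Rightarrow> nat"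
  assumes p: "\<forall>j. 0 < p j" and N: "\<And>j. \<bar>m j - m' j\<bar> < int N"
  shows "(\<Sum>l\<in>(\<Pi>\<^sub>E j\<in>UNIV. {..<N}). bloch_kernel p (torus_momentum N p l) m n * cnj (bloch_kernel p (torus_momentum N p l) m' n))
    = (if m = m' \<and> (\<forall>j. int (p j) dvd m j - n j) then of_nat N ^ CARD('d) else 0)"
proof (cases "(\<forall>j. int (p j) dvd m j - n j) \<and> (\<forall>j. int (p j) dvd m' j - n j)")
  case False
  then have "bloch_kernel p \<theta> m n * cnj (bloch_kernel p \<theta> m' n) = 0" for \<theta>
    by (auto simp: bloch_kernel_def)
  moreover have "\<not> (m = m' \<and> (\<forall>j. int (p j) dvd m j - n j))"
    using False by blast
  ultimately show ?thesis
    by (simp only: if_False sum.neutral_const)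
next
  case True
  have "int (p j) dvd m' j - m j" for j
    using True dvd_diff[of "int (p j)" "m' j - n j" "m j - n j"] by simp
  then obtain k where k: "\<And>j. m' j - m j = int (p j) * k j"
    unfolding dvd_def by metis
  have kN: "\<bar>k j\<bar> < int N" for j
  proof -
    have "1 \<le> int (p j)" using p[rule_format, of j] by linarith
    then have "\<bar>k j\<bar> \<le> \<bar>int (p j) * k j\<bar>"
      using mult_right_mono[of 1 "int (p j)" "\<bar>k j\<bar>"] by (simp add: abs_mult)
    then show ?thesis using N[of j] k[of j] by linarith
  qed
  have km: "m = m' \<longleftrightarrow> (\<forall>j. k j = 0)"
  proof -
    have "m j = m' j \<longleftrightarrow> k j = 0" for j
      using k[of j] p[rule_format, of j] by auto
    then show ?thesis by (simp add: fun_eq_iff)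
  qed
  have "bloch_kernel p (torus_momentum N p l) m n * cnj (bloch_kernel p (torus_momentum N p l) m' n) =
      (\<Prod>j\<in>UNIV. cis (2 * pi * (real (l j) * real_of_int (k j) / real N)))" for l
  proof -
    let ?t = "torus_momentum N p l"
    have "bloch_kernel p ?t m n * cnj (bloch_kernel p ?t m' n) =
        cis (2 * pi * (\<Sum>j\<in>UNIV. ?t j * real_of_int (n j - m j)) - 2 * pi * (\<Sum>j\<in>UNIV. ?t j * real_of_int (n j - m' j)))"
      using True by (simp add: bloch_kernel_def cis_cnj cis_mult)
    also have "2 * pi * (\<Sum>j\<in>UNIV. ?t j * real_of_int (n j - m j)) - 2 * pi * (\<Sum>j\<in>UNIV. ?t j * real_of_int (n j - m' j))
        = (\<Sum>j\<in>UNIV. 2 * pi * (real (l j) * real_of_int (k j) / real N))"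
      unfolding sum_distrib_left sum_subtractf[symmetric]
    proof (rule sum.cong[OF refl])
      fix j
      have "real_of_int (n j - m j) - real_of_int (n j - m' j) = real_of_int (m' j - m j)"
        by simp
      also have "\<dots> = real (p j) * real_of_int (k j)"
        unfolding k by simp
      finally have "?t j * (real_of_int (n j - m j) - real_of_int (n j - m' j)) = real (l j) * real_of_int (k j) / real N"
        using p[rule_format, of j] by (simp add: torus_momentum_def)
      then show "2 * pi * (?t j * real_of_int (n j - m j)) - 2 * pi * (?t j * real_of_int (n j - m' j)) =
          2 * pi * (real (l j) * real_of_int (k j) / real N)"
        by (simp only: right_diff_distrib[symmetric])
    qed
    also have "cis \<dots> = (\<Prod>j\<in>UNIV. cis (2 * pi * (real (l j) * real_of_int (k j) / real N)))"
      by (rule cis_sum) simp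
    finally show ?thesis .
  qed
  then have "(\<Sum>l\<in>(\<Pi>\<^sub>E j\<in>UNIV. {..<N}). bloch_kernel p (torus_momentum N p l) m n * cnj (bloch_kernel p (torus_momentum N p l) m' n))
      = (\<Prod>j\<in>(UNIV::'d set). \<Sum>l<N. cis (2 * pi * (real l * real_of_int (k j) / real N)))"
    by (simp add: prod_sum_PiE)
  also have "\<dots> = (if \<forall>j. k j = 0 then of_nat N ^ CARD('d) else 0)"
  proof (cases "\<forall>j. k j = 0")
    case False
    then obtain j where "k j \<noteq> 0" by blast
    then show ?thesis
      using sum_cis_int_multiple[OF kN[of j]] by (auto intro!: prod_zero bexI[of _ j])
  qed simp
  finally show ?thesis
    using True by (simp add: km)
qed

text \<open>Expanding the squares leaves a double sum over \<open>m\<close> and \<open>m'\<close>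
  from which orthogonality removes the off-diagonal terms. Each \<open>m\<close> is congruent to
  exactly one point of the cell, so it contributes the number of torus momenta once.\<close>

lemma bloch_sum_parseval:
  fixes p :: "'d::finite \<Rightarrow> nat"
  assumes p: "\<forall>j. 0 < p j" and F: "finite F" and N: "\<And>m m' j. m \<in> F \<Longrightarrow> m' \<in> F \<Longrightarrow> \<bar>m j - m' j\<bar> < int N"
  shows "(\<Sum>l\<in>(\<Pi>\<^sub>E j\<in>UNIV. {..<N}). \<Sum>n\<in>cell p. (cmod (bloch_sum F p (torus_momentum N p l) \<phi> n))\<^sup>2)
    = real N ^ CARD('d) * (\<Sum>m\<in>F. (cmod (\<phi> m))\<^sup>2)"
proof -
  let ?L = "\<Pi>\<^sub>E j\<in>(UNIV::'d set). {..<N}"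
  let ?k = "\<lambda>l. bloch_kernel p (torus_momentum N p l)"
  let ?D = "\<lambda>m n. \<forall>j. int (p j) dvd m j - n j"
  have sq: "of_real ((cmod (bloch_sum F p \<theta> \<phi> n))\<^sup>2) =
      (\<Sum>m\<in>F. \<Sum>m'\<in>F. \<phi> m * cnj (\<phi> m') * (bloch_kernel p \<theta> m n * cnj (bloch_kernel p \<theta> m' n)))" for \<theta> n
    unfolding complex_norm_square bloch_sum_def cnj_sum sum_product by (simp add: mult_ac)
  have cell1: "(\<Sum>n\<in>cell p. if ?D m n then c else 0) = c" for m and c :: complex
  proof -
    have "{n \<in> cell p. ?D m n} = {\<lambda>j. m j mod int (p j)}"
    proof (intro equalityI subsetI)
      fix n assume n: "n \<in> {n \<in> cell p. ?D m n}"
      have "n j = m j mod int (p j)" for j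
      proof -
        have "n j mod int (p j) = m j mod int (p j)"
          using n by (simp add: mod_eq_dvd_iff dvd_diff_commute)
        moreover have "n j mod int (p j) = n j"
          using n by (simp add: cell_def)
        ultimately show ?thesis by simp
      qed
      then show "n \<in> {\<lambda>j. m j mod int (p j)}" by auto
    next
      fix n assume "n \<in> {\<lambda>j. m j mod int (p j)}"
      then show "n \<in> {n \<in> cell p. ?D m n}"
        using p by (simp add: cell_def minus_mod_eq_mult_div)
    qed
    then show ?thesis
      by (simp add: finite_cell flip: sum.inter_filter)
  qed
  have orth: "(\<Sum>l\<in>?L. ?k l m n * cnj (?k l m' n)) = (if m = m' \<and> ?D m n then of_nat N ^ CARD('d) else 0)"
    if "m \<in> F" "m' \<in> F" for m m' n
    by (intro sum_bloch_kernel_orthogonal p N that)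
  have "of_real (\<Sum>l\<in>?L. \<Sum>n\<in>cell p. (cmod (bloch_sum F p (torus_momentum N p l) \<phi> n))\<^sup>2) =
      (\<Sum>l\<in>?L. \<Sum>n\<in>cell p. \<Sum>m\<in>F. \<Sum>m'\<in>F. \<phi> m * cnj (\<phi> m') * (?k l m n * cnj (?k l m' n)))"
    unfolding of_real_sum sq ..
  also have "\<dots> = (\<Sum>n\<in>cell p. \<Sum>l\<in>?L. \<Sum>m\<in>F. \<Sum>m'\<in>F. \<phi> m * cnj (\<phi> m') * (?k l m n * cnj (?k l m' n)))"
    by (rule sum.swap)
  also have "\<dots> = (\<Sum>n\<in>cell p. \<Sum>m\<in>F. \<Sum>m'\<in>F. \<phi> m * cnj (\<phi> m') * (\<Sum>l\<in>?L. ?k l m n * cnj (?k l m' n)))"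
    unfolding sum_distrib_left
    by (intro sum.cong refl, subst sum.swap, intro sum.cong refl, rule sum.swap)
  also have "\<dots> = (\<Sum>n\<in>cell p. \<Sum>m\<in>F. \<Sum>m'\<in>F. if m = m' then if ?D m n then \<phi> m * cnj (\<phi> m) * of_nat N ^ CARD('d) else 0 else 0)"
    by (intro sum.cong refl) (simp add: orth)
  also have "\<dots> = (\<Sum>n\<in>cell p. \<Sum>m\<in>F. if ?D m n then \<phi> m * cnj (\<phi> m) * of_nat N ^ CARD('d) else 0)"
    using F by (simp add: sum.delta')
  also have "\<dots> = (\<Sum>m\<in>F. \<Sum>n\<in>cell p. if ?D m n then \<phi> m * cnj (\<phi> m) * of_nat N ^ CARD('d) else 0)"
    by (rule sum.swap)
  also have "\<dots> = (\<Sum>m\<in>F. \<phi> m * cnj (\<phi> m) * of_nat N ^ CARD('d))"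
    unfolding cell1 ..
  also have "\<dots> = of_real (real N ^ CARD('d) * (\<Sum>m\<in>F. (cmod (\<phi> m))\<^sup>2))"
    unfolding of_real_mult of_real_sum complex_norm_square by (simp add: sum_distrib_left mult_ac)
  finally show ?thesis
    unfolding of_real_eq_iff .
qed

section \<open>Compactness in the quasimomentum\<close>

lemma finite_convergent_subsequence:
  fixes f :: "nat \<Rightarrow> 'i \<Rightarrow> 'b::heine_borel"
  assumes "finite I" "\<And>i. i \<in> I \<Longrightarrow> bounded (range (\<lambda>k. f k i))"
  shows "\<exists>r::nat \<Rightarrow> nat. strict_mono r \<and> (\<forall>i\<in>I. \<exists>l. (\<lambda>k. f (r k) i) \<longlonglongrightarrow> l)"
  using assms
proof (induction I rule: finite_induct)
  case empty
  show ?case by (intro exI[of _ id]) (auto simp: strict_mono_def)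
next
  case (insert i I)
  then obtain r where r: "strict_mono r" "\<forall>i\<in>I. \<exists>l. (\<lambda>k. f (r k) i) \<longlonglongrightarrow> l"
    by auto
  have "bounded (range (\<lambda>k. f (r k) i))"
    by (rule bounded_subset[OF insert.prems[of i]]) auto
  then obtain s l where s: "strict_mono s" "((\<lambda>k. f (r k) i) \<circ> s) \<longlonglongrightarrow> l"
    using bounded_imp_convergent_subsequence by blast
  have "\<exists>l. (\<lambda>k. f (r (s k)) i') \<longlonglongrightarrow> l" if "i' \<in> insert i I" for i'
  proof (cases "i' = i")
    case True
    with s show ?thesis by (auto simp: o_def)
  next
    case False
    with that r obtain l where "(\<lambda>k. f (r k) i') \<longlonglongrightarrow> l" by auto
    from LIMSEQ_subseq_LIMSEQ[OF this s(1)] show ?thesis by (auto simp: o_def)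
  qed
  moreover have "strict_mono (\<lambda>k. r (s k))"
    using strict_mono_o[OF r(1) s(1)] by (simp add: o_def)
  ultimately show ?case
    by (intro exI[of _ "\<lambda>k. r (s k)"]) simp
qed

lemma tendsto_floquet_ext:
  fixes p :: "'d::finite \<Rightarrow> nat"
  assumes p: "\<forall>j. 0 < p j" and \<Theta>: "\<And>j. (\<lambda>k. \<Theta> k j) \<longlonglongrightarrow> \<theta> j"
    and w: "\<And>n. n \<in> cell p \<Longrightarrow> (\<lambda>k. w k n) \<longlonglongrightarrow> w' n"
  shows "(\<lambda>k. floquet_ext p (\<Theta> k) (w k) n) \<longlonglongrightarrow> floquet_ext p \<theta> w' n"
  unfolding floquet_ext_def cis_conv_exp using p
  by (intro tendsto_intros \<Theta> w) (simp add: cell_def)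

lemma tendsto_schrodinger:
  assumes "\<And>n. (\<lambda>k. \<psi> k n) \<longlonglongrightarrow> \<psi>' n"
  shows "(\<lambda>k. schrodinger V (\<psi> k) n) \<longlonglongrightarrow> schrodinger V \<psi>' n"
  unfolding schrodinger_def by (intro tendsto_intros assms)

lemma schrodinger_scale: "schrodinger V (\<lambda>n. c * \<psi> n) n = c * schrodinger V \<psi> n"
  by (simp add: schrodinger_def sum_distrib_left distrib_left mult_ac)

text \<open>Together with \<open>floquet_space_eqI\<close> this allows an eigenvalue equation to be
  checked on the cell alone.\<close>

lemma schrodinger_in_floquet_space:
  assumes V: "periodic_potential p V" and v: "v \<in> floquet_space p \<theta>"
  shows "schrodinger V v \<in> floquet_space p \<theta>"
  unfolding floquet_space_def
proof (intro CollectI allI)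
  fix n j
  let ?c = "cis (2 * pi * real (p j) * \<theta> j)"
  define a where "a i = (if i = j then int (p j) else 0)" for i
  have a: "m(j := m j + int (p j)) = (\<lambda>i. m i + a i)" for m
    by (auto simp: a_def)
  have va: "v (\<lambda>i. m i + a i) = ?c * v m" for m
    using v unfolding a[symmetric] floquet_space_def by blast
  have "V (\<lambda>i. n i + a i) = V n"
    using V unfolding a[symmetric] periodic_potential_def by blast
  then show "schrodinger V v (n(j := n j + int (p j))) = ?c * schrodinger V v n"
    unfolding a schrodinger_def sum_neighbours_translate va sum_distrib_left[symmetric]
    by (simp add: algebra_simps)
qed

lemma floquet_space_scale: "v \<in> floquet_space p \<theta> \<Longrightarrow> (\<lambda>n. c * v n) \<in> floquet_space p \<theta>"
  by (simp add: floquet_space_def mult_ac)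

lemma floquet_space_eqI:
  assumes "\<forall>j. 0 < p j" "u \<in> floquet_space p (\<theta> :: 'd::finite \<Rightarrow> real)" "v \<in> floquet_space p \<theta>"
    and "\<And>n. n \<in> cell p \<Longrightarrow> u n = v n"
  shows "u = v"
  using floquet_ext_cong[of p u v \<theta>] assms floquet_space_eq_ext by metis

text \<open>The periods are integers, so the multipliers depend on the quasimomentum only modulo 1.
  Absence of Bloch solutions thereby passes from the half-open cube \<open>quasimomenta\<close> to
  the closed cube, where compactness is available.\<close>

lemma floquet_space_frac: "floquet_space p (\<lambda>j. frac (\<theta> j)) = floquet_space p \<theta>"
proof -
  have "cis (2 * pi * real (p j) * frac (\<theta> j)) = cis (2 * pi * real (p j) * \<theta> j)" for j
  proof -
    have "2 * pi * real (p j) * \<theta> j = 2 * pi * real (p j) * frac (\<theta> j) + 2 * pi * real_of_int (int (p j) * \<lfloor>\<theta> j\<rfloor>)"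
      by (simp add: frac_def algebra_simps)
    then have "cis (2 * pi * real (p j) * \<theta> j) =
        cis (2 * pi * real (p j) * frac (\<theta> j)) * cis (2 * pi * real_of_int (int (p j) * \<lfloor>\<theta> j\<rfloor>))"
      by (simp only: cis_mult)
    also have "cis (2 * pi * real_of_int (int (p j) * \<lfloor>\<theta> j\<rfloor>)) = 1"
      by (rule cis_multiple_2pi) (rule Ints_of_int)
    finally show ?thesis by simp
  qed
  then show ?thesis by (simp add: floquet_space_def)
qed

text \<open>Otherwise there are almost solutions, normalised on the cell. Along a subsequence the
  quasimomenta and the values on the cell converge, and the limit is a Bloch solution that is
  nonzero because the normalisation survives on a finite cell.\<close>

lemma bloch_uniform_lower_bound:
  fixes V :: "('d::finite \<Rightarrow> int) \<Rightarrow> real"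
  assumes V: "periodic_potential p V"
    and no: "\<And>\<theta> v. v \<in> floquet_space p \<theta> \<Longrightarrow> (\<And>n. schrodinger V v n = z * v n) \<Longrightarrow> v = (\<lambda>n. 0)"
  shows "\<exists>c>0. \<forall>\<theta>. (\<forall>j. 0 \<le> \<theta> j \<and> \<theta> j \<le> 1) \<longrightarrow> (\<forall>v\<in>floquet_space p \<theta>.
    c * (\<Sum>n\<in>cell p. (cmod (v n))\<^sup>2) \<le> (\<Sum>n\<in>cell p. (cmod (schrodinger V v n - z * v n))\<^sup>2))"
proof (rule ccontr)
  have p: "\<forall>j. 0 < p j" using V by (simp add: periodic_potential_def)
  let ?S = "\<lambda>v. \<Sum>n\<in>cell p. (cmod (v n))\<^sup>2"
  let ?B = "\<lambda>v n. schrodinger V v n - z * v n"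
  assume neg: "\<not> ?thesis"
  then have neg': "\<forall>c>0. \<exists>\<theta>. (\<forall>j. 0 \<le> \<theta> j \<and> \<theta> j \<le> 1) \<and> (\<exists>v\<in>floquet_space p \<theta>. ?S (?B v) < c * ?S v)"
    by (simp add: not_le)
  define Q where "Q k x \<longleftrightarrow> (\<forall>j. 0 \<le> fst x j \<and> fst x j \<le> 1) \<and> snd x \<in> floquet_space p (fst x) \<and>
    ?S (?B (snd x)) < inverse (real (Suc k)) * ?S (snd x)" for k :: nat and x
  have "\<forall>k. \<exists>x. Q k x"
  proof
    fix k
    have "inverse (real (Suc k)) > 0" by simp
    from neg'[rule_format, OF this] obtain \<theta> v where "Q k (\<theta>, v)"
      unfolding Q_def by auto
    then show "\<exists>x. Q k x" ..
  qed
  from choice[OF this] obtain f where f: "\<And>k. Q k (f k)" by blast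
  define \<Theta> where "\<Theta> k = fst (f k)" for k
  define v where "v k = snd (f k)" for k
  have \<Theta>: "\<And>k j. 0 \<le> \<Theta> k j \<and> \<Theta> k j \<le> 1" and v: "\<And>k. v k \<in> floquet_space p (\<Theta> k)"
    and Bv: "\<And>k. ?S (?B (v k)) < inverse (real (Suc k)) * ?S (v k)"
    using f unfolding Q_def \<Theta>_def v_def by blast+
  have S0: "?S w \<ge> 0" for w by (intro sum_nonneg) simp
  have S: "?S (v k) > 0" for k
    using order_le_less_trans[OF S0 Bv[of k]] by (simp add: zero_less_mult_iff)
  define u where "u k n = of_real (1 / sqrt (?S (v k))) * v k n" for k n
  have u_eq: "u k = (\<lambda>n. of_real (1 / sqrt (?S (v k))) * v k n)" for k
    by (rule ext) (rule u_def)
  have u: "u k \<in> floquet_space p (\<Theta> k)" for k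
    unfolding u_eq by (rule floquet_space_scale[OF v])
  have scale: "?S (\<lambda>n. of_real (1 / sqrt (?S (v k))) * w n) = ?S w / ?S (v k)" for k w
    unfolding sum_divide_distrib
  proof (rule sum.cong[OF refl])
    fix n
    have "(1 / sqrt (?S (v k)))\<^sup>2 = 1 / ?S (v k)"
      using S[of k] by (simp add: power_divide)
    then show "(cmod (of_real (1 / sqrt (?S (v k))) * w n))\<^sup>2 = (cmod (w n))\<^sup>2 / ?S (v k)"
      unfolding norm_mult norm_of_real power_mult_distrib power2_abs by simp
  qed
  have Su: "?S (u k) = 1" for k
    unfolding u_eq scale using S[of k] by simp
  have Bu: "?S (?B (u k)) < inverse (real (Suc k))" for k
  proof -
    have "?B (u k) = (\<lambda>n. of_real (1 / sqrt (?S (v k))) * ?B (v k) n)"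
      unfolding u_eq by (simp only: schrodinger_scale right_diff_distrib mult.left_commute)
    from arg_cong[where f = ?S, OF this] have "?S (?B (u k)) = ?S (?B (v k)) / ?S (v k)"
      unfolding scale .
    with Bv[of k] S[of k] show ?thesis by (simp add: divide_less_eq mult.commute)
  qed
  have "bounded (range (\<lambda>k. \<Theta> k j))" for j
    using \<Theta> by (intro boundedI[of _ 1]) (auto simp: abs_le_iff intro: order_trans[of _ 0])
  then obtain r where r: "strict_mono r" "\<forall>j\<in>UNIV. \<exists>l. (\<lambda>k. \<Theta> (r k) j) \<longlonglongrightarrow> l"
    using finite_convergent_subsequence[of UNIV \<Theta>] by auto
  have "cmod (u k n) \<le> 1" if "n \<in> cell p" for k n
  proof -
    have "(cmod (u k n))\<^sup>2 \<le> ?S (u k)"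
      using that finite_cell by (intro member_le_sum) auto
    then show ?thesis
      using Su[of k] by (simp add: power_le_one_iff abs_square_le_1)
  qed
  then have "bounded (range (\<lambda>k. u (r k) n))" if "n \<in> cell p" for n
    using that by (intro boundedI[of _ 1]) auto
  then obtain s where s: "strict_mono s" "\<forall>n\<in>cell p. \<exists>l. (\<lambda>k. u (r (s k)) n) \<longlonglongrightarrow> l"
    using finite_convergent_subsequence[OF finite_cell, of p "\<lambda>k. u (r k)"] by auto
  define t where "t = r \<circ> s"
  have t: "strict_mono t" unfolding t_def by (rule strict_mono_o[OF r(1) s(1)])
  have "\<exists>l. (\<lambda>k. \<Theta> (t k) j) \<longlonglongrightarrow> l" for j
    using r(2) LIMSEQ_subseq_LIMSEQ[OF _ s(1)] unfolding t_def o_def by blast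
  then have "\<forall>j. \<exists>l. (\<lambda>k. \<Theta> (t k) j) \<longlonglongrightarrow> l" ..
  from choice[OF this] obtain \<theta> where \<theta>: "\<And>j. (\<lambda>k. \<Theta> (t k) j) \<longlonglongrightarrow> \<theta> j" by blast
  have "\<forall>n\<in>cell p. \<exists>l. (\<lambda>k. u (t k) n) \<longlonglongrightarrow> l"
    using s(2) by (simp add: t_def)
  from bchoice[OF this] obtain w where w: "\<And>n. n \<in> cell p \<Longrightarrow> (\<lambda>k. u (t k) n) \<longlonglongrightarrow> w n" by blast
  \<comment> \<open>The functions live in different Floquet spaces, and convergence is known only on
    the cell. Extending with the limit quasimomentum gives convergence at every site, in particular
    at the neighbours of the cell that the operator involves.\<close>
  define v' where "v' = floquet_ext p \<theta> w"
  have v': "v' \<in> floquet_space p \<theta>"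
    unfolding v'_def by (rule floquet_ext_in_space[OF p])
  have lim: "(\<lambda>k. u (t k) n) \<longlonglongrightarrow> v' n" for n
  proof -
    have "(\<lambda>k. floquet_ext p (\<Theta> (t k)) (u (t k)) n) \<longlonglongrightarrow> floquet_ext p \<theta> w n"
      by (rule tendsto_floquet_ext[OF p \<theta> w])
    then show ?thesis unfolding v'_def floquet_space_eq_ext[OF u] .
  qed
  have "(\<lambda>k. ?S (u (t k))) \<longlonglongrightarrow> ?S v'"
    by (intro tendsto_intros lim)
  then have Sv': "?S v' = 1"
    unfolding Su using LIMSEQ_unique tendsto_const by blast
  have "schrodinger V v' n = (\<lambda>n. z * v' n) n" if n: "n \<in> cell p" for n
  proof -
    have "(\<lambda>k. (cmod (?B (u (t k)) n))\<^sup>2) \<longlonglongrightarrow> (cmod (?B v' n))\<^sup>2"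
      by (intro tendsto_intros lim tendsto_schrodinger)
    moreover have "(\<lambda>k. (cmod (?B (u (t k)) n))\<^sup>2) \<longlonglongrightarrow> 0"
    proof (rule tendsto_sandwich[OF _ _ tendsto_const])
      show "(\<lambda>k. inverse (real (Suc (t k)))) \<longlonglongrightarrow> 0"
        using LIMSEQ_subseq_LIMSEQ[OF LIMSEQ_inverse_real_of_nat t] by (simp add: o_def)
      have "(cmod (?B (u (t k)) n))\<^sup>2 \<le> ?S (?B (u (t k)))" for k
        using n finite_cell by (intro member_le_sum[where f = "\<lambda>n. (cmod (?B (u (t k)) n))\<^sup>2"]) auto
      then have "(cmod (?B (u (t k)) n))\<^sup>2 \<le> inverse (real (Suc (t k)))" for k
        using Bu[of "t k"] by (meson less_imp_le order_trans)
      then show "\<forall>\<^sub>F k in sequentially. (cmod (?B (u (t k)) n))\<^sup>2 \<le> inverse (real (Suc (t k)))"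
        by simp
    qed simp
    ultimately have "(cmod (?B v' n))\<^sup>2 = 0"
      using LIMSEQ_unique by blast
    then show ?thesis by simp
  qed
  then have "schrodinger V v' = (\<lambda>n. z * v' n)"
    by (rule floquet_space_eqI[OF p schrodinger_in_floquet_space[OF V v'] floquet_space_scale[OF v']])
  then have "v' = (\<lambda>n. 0)"
    using no[OF v'] by (metis)
  with Sv' show False by simp
qed

text \<open>The torus has to grow with the support of the test function. Uniformity in the
  quasimomentum is what keeps the constant \<open>c\<close> independent of it, so that one lower
  bound \<open>sqrt c\<close> serves all finitely supported functions.\<close>

lemma spec_imp_bloch_solution:
  fixes V :: "('d::finite \<Rightarrow> int) \<Rightarrow> real"
  assumes T: "bounded_op (schrodinger V)" "selfadjoint_op (schrodinger V)"
    and V: "periodic_potential p V" and x: "x \<in> spec (schrodinger V)"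
  shows "\<exists>\<theta>\<in>quasimomenta. \<exists>v\<in>floquet_space p \<theta>. v \<noteq> (\<lambda>n. 0) \<and> (\<forall>n. schrodinger V v n = of_real x * v n)"
proof (rule ccontr)
  assume neg: "\<not> ?thesis"
  have p: "\<forall>j. 0 < p j" using V by (simp add: periodic_potential_def)
  let ?z = "complex_of_real x"
  have no: "v = (\<lambda>n. 0)" if "v \<in> floquet_space p \<theta>" "\<And>n. schrodinger V v n = ?z * v n" for \<theta> v
  proof -
    have "(\<lambda>j. frac (\<theta> j)) \<in> quasimomenta"
      by (simp add: quasimomenta_def frac_lt_1)
    with neg that show ?thesis
      using floquet_space_frac by metis
  qed
  have "\<exists>c>0. \<forall>\<theta>. (\<forall>j. 0 \<le> \<theta> j \<and> \<theta> j \<le> 1) \<longrightarrow> (\<forall>v\<in>floquet_space p \<theta>.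
    c * (\<Sum>n\<in>cell p. (cmod (v n))\<^sup>2) \<le> (\<Sum>n\<in>cell p. (cmod (schrodinger V v n - ?z * v n))\<^sup>2))"
    by (rule bloch_uniform_lower_bound[OF V no])
  then obtain c where c: "c > 0" "\<And>\<theta> v. (\<forall>j. 0 \<le> \<theta> j \<and> \<theta> j \<le> 1) \<Longrightarrow> v \<in> floquet_space p \<theta> \<Longrightarrow>
    c * (\<Sum>n\<in>cell p. (cmod (v n))\<^sup>2) \<le> (\<Sum>n\<in>cell p. (cmod (schrodinger V v n - ?z * v n))\<^sup>2)"
    by blast
  have "sqrt c * ell2_norm \<psi> \<le> ell2_norm (\<lambda>n. schrodinger V \<psi> n - ?z * \<psi> n)"
    if fin: "finite {n. \<psi> n \<noteq> 0}" for \<psi>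
  proof -
    \<comment> \<open>Adding the neighbours lets the same \<open>F\<close> carry
      \<open>\<psi>\<close> and its image \<open>\<phi>\<close>, so that Parseval's identity applies
      to both.\<close>
    define F where "F = {n. \<psi> n \<noteq> 0} \<union> (\<Union>a\<in>{n. \<psi> n \<noteq> 0}. {m. dist1 m a = 1})"
    have F: "finite F" unfolding F_def using fin finite_neighbours by auto
    have supp: "m \<in> F" if "\<psi> a \<noteq> 0" "m = a \<or> dist1 m a = 1" for m a
      using that by (auto simp: F_def)
    define \<phi> where "\<phi> = (\<lambda>n. schrodinger V \<psi> n - ?z * \<psi> n)"
    have \<psi>0: "\<psi> n = 0" if "n \<notin> F" for n using that supp by blast
    have \<phi>0: "\<phi> n = 0" if "n \<notin> F" for n
    proof -
      have "(\<Sum>m | dist1 m n = 1. \<psi> m) = 0"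
      proof (intro sum.neutral ballI)
        fix m assume "m \<in> {m. dist1 m n = 1}"
        then have "dist1 n m = 1" by (simp add: dist1_commute)
        then show "\<psi> m = 0" using supp[of m n] that by blast
      qed
      then show ?thesis using \<psi>0[OF that] by (simp add: \<phi>_def schrodinger_def)
    qed
    define K where "K = (\<Sum>m\<in>F. \<Sum>j\<in>UNIV. \<bar>m j\<bar>)"
    have K: "\<bar>m j\<bar> \<le> K" if "m \<in> F" for m j
    proof -
      have "\<bar>m j\<bar> \<le> (\<Sum>j\<in>UNIV. \<bar>m j\<bar>)" by (rule member_le_sum) auto
      also have "\<dots> \<le> K"
        unfolding K_def using that F by (intro member_le_sum sum_nonneg) auto
      finally show ?thesis .
    qed
    \<comment> \<open>Coordinates of points in \<open>F\<close> differ by at most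
      \<open>2 * K\<close>, so distinct points of \<open>F\<close> stay distinct on the
      torus.\<close>
    define N where "N = nat (2 * K + 1)"
    have K0: "K \<ge> 0" unfolding K_def by (intro sum_nonneg) auto
    then have N0: "N > 0" by (simp add: N_def)
    have N: "\<bar>m j - m' j\<bar> < int N" if "m \<in> F" "m' \<in> F" for m m' j
      using K[OF that(1), of j] K[OF that(2), of j] K0 by (simp add: N_def)
    let ?L = "\<Pi>\<^sub>E j\<in>(UNIV::'d set). {..<N}"
    let ?P = "\<lambda>l. bloch_sum F p (torus_momentum N p l)"
    have P: "schrodinger V (?P l \<psi>) n - ?z * ?P l \<psi> n = ?P l \<phi> n" for l n
    proof -
      have "schrodinger V (?P l \<psi>) n = ?P l (schrodinger V \<psi>) n"
        by (rule schrodinger_bloch_sum[OF V F]) (rule supp)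
      then show ?thesis by (simp only: \<phi>_def bloch_sum_diff)
    qed
    have le: "c * (\<Sum>n\<in>cell p. (cmod (?P l \<psi> n))\<^sup>2) \<le> (\<Sum>n\<in>cell p. (cmod (?P l \<phi> n))\<^sup>2)" if l: "l \<in> ?L" for l
    proof -
      have "0 \<le> torus_momentum N p l j \<and> torus_momentum N p l j \<le> 1" for j
      proof -
        have "l j < N" using l by (simp add: PiE_iff)
        then have "l j * 1 \<le> N * p j"
          using p[rule_format, of j] by (intro mult_le_mono) auto
        then have "real (l j) \<le> real N * real (p j)"
          by (simp only: mult_1_right of_nat_mult[symmetric] of_nat_le_iff)
        then show ?thesis
          using N0 p[rule_format, of j] by (simp add: torus_momentum_def divide_le_eq)
      qed
      then show ?thesis
        using c(2)[of "torus_momentum N p l" "?P l \<psi>"] by (simp add: P bloch_sum_in_floquet_space)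
    qed
    have pars: "(\<Sum>l\<in>?L. \<Sum>n\<in>cell p. (cmod (?P l \<eta> n))\<^sup>2) = real N ^ CARD('d) * (\<Sum>m\<in>F. (cmod (\<eta> m))\<^sup>2)" for \<eta>
      by (rule bloch_sum_parseval[OF p F]) (rule N)
    have norm_\<psi>: "(ell2_norm \<psi>)\<^sup>2 = (\<Sum>m\<in>F. (cmod (\<psi> m))\<^sup>2)"
      by (rule ell2_norm_finite_support[OF F]) (rule \<psi>0)
    have norm_\<phi>: "(ell2_norm \<phi>)\<^sup>2 = (\<Sum>m\<in>F. (cmod (\<phi> m))\<^sup>2)"
      by (rule ell2_norm_finite_support[OF F]) (rule \<phi>0)
    from le have "c * (\<Sum>l\<in>?L. \<Sum>n\<in>cell p. (cmod (?P l \<psi> n))\<^sup>2) \<le> (\<Sum>l\<in>?L. \<Sum>n\<in>cell p. (cmod (?P l \<phi> n))\<^sup>2)"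
      unfolding sum_distrib_left[of c "\<lambda>l. \<Sum>n\<in>cell p. (cmod (?P l \<psi> n))\<^sup>2"] by (rule sum_mono)
    then have "c * (real N ^ CARD('d) * (ell2_norm \<psi>)\<^sup>2) \<le> real N ^ CARD('d) * (ell2_norm \<phi>)\<^sup>2"
      unfolding pars norm_\<psi> norm_\<phi> .
    then have "(sqrt c * ell2_norm \<psi>)\<^sup>2 \<le> (ell2_norm \<phi>)\<^sup>2"
      using N0 c(1) by (simp add: power_mult_distrib mult.left_commute[of c])
    then show ?thesis
      unfolding \<phi>_def by (rule power2_le_imp_le) simp
  qed
  then have "bounded_below_op (schrodinger V) ?z"
    using c(1) by (intro bounded_below_op_finite_support[OF T(1), of "sqrt c"]) auto
  with x not_in_spec_iff[OF T] show False by blast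
qed

section \<open>Spectral bands\<close>

lemma floquet_matrix_carrier: "floquet_matrix p V \<theta> \<in> carrier_mat (cell_size p) (cell_size p)"
  by (simp add: floquet_matrix_def)

lemma floquet_matrix_mult_vec:
  assumes p: "\<forall>j. 0 < (p :: 'd::finite \<Rightarrow> nat) j" and v: "v \<in> floquet_space p \<theta>"
    and r: "r < cell_size p"
  shows "vec_index (mult_mat_vec (floquet_matrix p V \<theta>) (Matrix.vec (cell_size p) (\<lambda>s. v (cell_enum p s)))) r =
    schrodinger V v (cell_enum p r)"
proof -
  have "dim_row (floquet_matrix p V \<theta>) = cell_size p" "dim_col (floquet_matrix p V \<theta>) = cell_size p"
    by (simp_all add: floquet_matrix_def)
  then show ?thesis
    using r by (simp add: floquet_matrix_action[OF p v r] scalar_prod_def lessThan_atLeast0)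
qed

text \<open>Vectors and Floquet functions correspond through the values on the enumerated cell. The
  matrix gives the equation on the cell only; it extends because both sides lie in the same Floquet
  space.\<close>

lemma floquet_matrix_eigenvalue_iff:
  fixes p :: "'d::finite \<Rightarrow> nat"
  assumes V: "periodic_potential p V"
  shows "eigenvalue (floquet_matrix p V \<theta>) z \<longleftrightarrow>
    (\<exists>v\<in>floquet_space p \<theta>. v \<noteq> (\<lambda>n. 0) \<and> (\<forall>n. schrodinger V v n = z * v n))"
proof
  let ?M = "floquet_matrix p V \<theta>" and ?q = "cell_size p"
  have p: "\<forall>j. 0 < p j" using V by (simp add: periodic_potential_def)
  have dim: "dim_row ?M = ?q" by (simp add: floquet_matrix_def)
  have cellE: "\<exists>s<?q. n = cell_enum p s" if "n \<in> cell p" for n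
    using that cell_enum_bij[of p] by (auto simp: bij_betw_def)
  have enum_cell: "cell_enum p s \<in> cell p" if "s < ?q" for s
    using that cell_enum_bij[of p] by (auto simp: bij_betw_def)
  {
    assume "eigenvalue ?M z"
    then obtain u where u: "u \<in> carrier_vec ?q" "u \<noteq> 0\<^sub>v ?q" "mult_mat_vec ?M u = smult_vec z u"
      unfolding eigenvalue_def eigenvector_def dim by blast
    define w where "w n = vec_index u (the_inv_into {..<?q} (cell_enum p) n)" for n
    define v where "v = floquet_ext p \<theta> w"
    have v: "v \<in> floquet_space p \<theta>"
      unfolding v_def by (rule floquet_ext_in_space[OF p])
    have vs: "v (cell_enum p s) = vec_index u s" if "s < ?q" for s
      using that cell_enum_bij[of p]
      by (simp add: v_def floquet_ext_on_cell[OF enum_cell] w_def bij_betw_def the_inv_into_f_f)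
    have uv: "u = Matrix.vec ?q (\<lambda>s. v (cell_enum p s))"
      using u(1) vs by (intro eq_vecI) auto
    have "schrodinger V v n = (\<lambda>n. z * v n) n" if n: "n \<in> cell p" for n
    proof -
      obtain s where s: "s < ?q" "n = cell_enum p s" using cellE[OF n] by blast
      have "schrodinger V v n = vec_index (mult_mat_vec ?M u) s"
        unfolding s(2) uv by (rule floquet_matrix_mult_vec[OF p v s(1), symmetric])
      also have "\<dots> = z * v n"
        using s u(1) by (simp add: u(3) vs)
      finally show ?thesis .
    qed
    then have "schrodinger V v = (\<lambda>n. z * v n)"
      by (rule floquet_space_eqI[OF p schrodinger_in_floquet_space[OF V v] floquet_space_scale[OF v]])
    moreover have "v \<noteq> (\<lambda>n. 0)"
    proof
      assume v0: "v = (\<lambda>n. 0)"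
      have "u = 0\<^sub>v ?q"
        unfolding uv v0 by (intro eq_vecI) auto
      with u(2) show False ..
    qed
    ultimately show "\<exists>v\<in>floquet_space p \<theta>. v \<noteq> (\<lambda>n. 0) \<and> (\<forall>n. schrodinger V v n = z * v n)"
      using v by (intro bexI[of _ v]) auto
  next
    assume "\<exists>v\<in>floquet_space p \<theta>. v \<noteq> (\<lambda>n. 0) \<and> (\<forall>n. schrodinger V v n = z * v n)"
    then obtain v where v: "v \<in> floquet_space p \<theta>" "v \<noteq> (\<lambda>n. 0)" "\<And>n. schrodinger V v n = z * v n"
      by blast
    let ?u = "Matrix.vec ?q (\<lambda>s. v (cell_enum p s))"
    have "?u \<noteq> 0\<^sub>v ?q"
    proof
      assume u0: "?u = 0\<^sub>v ?q"
      \<comment> \<open>Zero is written as a multiple of \<open>v\<close> in order to exhibit it as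
        a member of the same Floquet space.\<close>
      have "v n = (\<lambda>n. 0 * v n) n" if n: "n \<in> cell p" for n
      proof -
        obtain s where s: "s < ?q" "n = cell_enum p s" using cellE[OF n] by blast
        have "vec_index ?u s = vec_index (0\<^sub>v ?q) s" by (simp only: u0)
        then show ?thesis using s by simp
      qed
      then have "v = (\<lambda>n. 0 * v n)"
        by (rule floquet_space_eqI[OF p v(1) floquet_space_scale[OF v(1)]])
      then show False using v(2) by simp
    qed
    moreover have "mult_mat_vec ?M ?u = smult_vec z ?u"
    proof (rule eq_vecI)
      fix r assume "r < dim_vec (smult_vec z ?u)"
      then have r: "r < ?q" by simp
      show "vec_index (mult_mat_vec ?M ?u) r = vec_index (smult_vec z ?u) r"
        unfolding floquet_matrix_mult_vec[OF p v(1) r] using r by (simp add: v(3))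
    qed (simp add: dim)
    ultimately show "eigenvalue ?M z"
      unfolding eigenvalue_def eigenvector_def dim by (intro exI[of _ ?u]) auto
  }
qed

section \<open>Continuity of the ordered eigenvalues\<close>

lemma tendsto_det:
  fixes A :: "nat \<Rightarrow> complex mat"
  assumes "\<And>k. A k \<in> carrier_mat q q" "B \<in> carrier_mat q q"
    and "\<And>i j. i < q \<Longrightarrow> j < q \<Longrightarrow> (\<lambda>k. A k $$ (i, j)) \<longlonglongrightarrow> B $$ (i, j)"
  shows "(\<lambda>k. Determinant.det (A k)) \<longlonglongrightarrow> Determinant.det B"
proof -
  have d: "dim_row (A k) = q" "dim_col (A k) = q" "dim_row B = q" "dim_col B = q" for k
    using assms(1)[of k] assms(2) by auto
  have "p i < q" if "p permutes {0..<q}" "i < q" for p i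
    using permutes_in_image[OF that(1), of i] that(2) by simp
  then show ?thesis
    unfolding Determinant.det_def d by (auto intro!: tendsto_intros assms(3))
qed

text \<open>The quasimomentum enters the matrix only through phases, and the determinant is a
  polynomial in the entries.\<close>

lemma tendsto_char_poly_floquet_matrix:
  fixes p :: "'d::finite \<Rightarrow> nat"
  assumes p: "\<forall>j. 0 < p j" and \<Theta>: "\<And>j. (\<lambda>k. \<Theta> k j) \<longlonglongrightarrow> \<theta> j"
  shows "(\<lambda>k. poly (char_poly (floquet_matrix p V (\<Theta> k))) z) \<longlonglongrightarrow> poly (char_poly (floquet_matrix p V \<theta>)) z"
  unfolding char_poly_matrix[OF floquet_matrix_carrier]
proof (rule tendsto_det)
  let ?q = "cell_size p"
  show "- char_matrix (floquet_matrix p V \<theta>) z \<in> carrier_mat ?q ?q" for \<theta>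
    by (simp add: char_matrix_closed[OF floquet_matrix_carrier])
  then show "- char_matrix (floquet_matrix p V \<theta>) z \<in> carrier_mat ?q ?q" .
  fix i j assume ij: "i < ?q" "j < ?q"
  have e: "(- char_matrix (floquet_matrix p V \<theta>) z) $$ (i, j) =
      (if i = j then z else 0) - schrodinger V (floquet_ext p \<theta> (\<lambda>m. if m = cell_enum p j then 1 else 0)) (cell_enum p i)" for \<theta>
    using ij by (simp add: char_matrix_def floquet_matrix_def)
  show "(\<lambda>k. (- char_matrix (floquet_matrix p V (\<Theta> k)) z) $$ (i, j)) \<longlonglongrightarrow>
      (- char_matrix (floquet_matrix p V \<theta>) z) $$ (i, j)"
    unfolding e by (intro tendsto_intros tendsto_schrodinger tendsto_floquet_ext p \<Theta>)
qed

lemma proots_linear_factors: "proots (\<Prod>x\<leftarrow>xs. [:- x, 1:]) = mset (xs :: 'a::idom list)"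
proof (induction xs)
  case (Cons x xs)
  have "(\<Prod>x\<leftarrow>xs. [:- x, 1:]) \<noteq> 0"
    by (auto simp: prod_list_zero_iff)
  then have "proots ([:- x, 1:] * (\<Prod>x\<leftarrow>xs. [:- x, 1:])) = proots [:- x, 1:] + proots (\<Prod>x\<leftarrow>xs. [:- x, 1:])"
    by (intro proots_mult) auto
  then show ?case
    using Cons.IH proots_linear_factor[of "- x"] by simp
qed simp

lemma poly_linear_factors:
  fixes y :: "'a::comm_ring_1"
  shows "poly (\<Prod>x\<leftarrow>xs. [:- x, 1:]) y = (\<Prod>x\<leftarrow>xs. y - x)"
  by (induction xs) (simp_all add: algebra_simps)

lemma of_real_prod_mset:
  "of_real (\<Prod>a\<in>#M. f a) = (\<Prod>a\<in>#M. of_real (f a) :: 'b::real_field)"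
  by (induction M) simp_all

text \<open>
  Along any subsequence on which all roots converge, their limits are the roots of the limit
  polynomial, in increasing order.
\<close>

lemma sorted_roots_tendsto:
  fixes L :: "nat \<Rightarrow> real list"
  assumes len: "\<And>k. length (L k) = q" "length K = q"
    and sorted: "\<And>k. sorted (L k)" "sorted K"
    and lim: "\<And>y. (\<lambda>k. \<Prod>x\<leftarrow>L k. y - x) \<longlonglongrightarrow> (\<Prod>x\<leftarrow>K. y - x)"
    and bd: "\<And>k x. x \<in> set (L k) \<Longrightarrow> \<bar>x\<bar> \<le> B" and i: "i < q"
  shows "(\<lambda>k. L k ! i) \<longlonglongrightarrow> K ! i"
proof (rule ccontr)
  assume "\<not> ?thesis"
  then obtain e where e: "e > 0" "\<not> (\<forall>\<^sub>F k in sequentially. dist (L k ! i) (K ! i) < e)"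
    unfolding tendsto_iff by blast
  obtain r :: "nat \<Rightarrow> nat" where r: "strict_mono r" "\<And>k. \<not> dist (L (r k) ! i) (K ! i) < e"
    using not_eventually_sequentiallyD[OF e(2)] by blast
  have "bounded (range (\<lambda>k. L (r k) ! j))" if "j \<in> {..<q}" for j
  proof (rule boundedI[of _ B])
    fix x assume "x \<in> range (\<lambda>k. L (r k) ! j)"
    then obtain k where "x = L (r k) ! j" by blast
    then have "x \<in> set (L (r k))" using that len(1) by simp
    then show "norm x \<le> B" using bd by simp
  qed
  \<comment> \<open>Inside a subsequence on which the \<open>i\<close>-th root stays at distance
    \<open>e\<close> from \<open>K ! i\<close>, a further one makes all roots converge.\<close>
  then obtain s where s: "strict_mono s" "\<forall>j\<in>{..<q}. \<exists>l. (\<lambda>k. L (r (s k)) ! j) \<longlonglongrightarrow> l"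
    using finite_convergent_subsequence[of "{..<q}" "\<lambda>k j. L (r k) ! j"] by auto
  from bchoice[OF s(2)] obtain \<mu> where \<mu>: "\<And>j. j < q \<Longrightarrow> (\<lambda>k. L (r (s k)) ! j) \<longlonglongrightarrow> \<mu> j"
    by auto
  define M where "M = map \<mu> [0..<q]"
  have prod_nth: "(\<Prod>x\<leftarrow>xs. y - x) = (\<Prod>j<q. y - xs ! j)" if "length xs = q" for xs and y :: real
    using that by (simp add: prod.list_conv_set_nth lessThan_atLeast0)
  have "sorted M"
    unfolding sorted_iff_nth_mono
  proof (intro allI impI)
    fix a b assume ab: "a \<le> b" "b < length M"
    then have "b < q" by (simp add: M_def)
    have "L (r (s k)) ! a \<le> L (r (s k)) ! b" for k
      using ab \<open>b < q\<close> sorted(1) len(1) by (intro sorted_nth_mono) auto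
    then have "\<mu> a \<le> \<mu> b"
      using ab \<open>b < q\<close> by (intro LIMSEQ_le[OF \<mu> \<mu>]) auto
    then show "M ! a \<le> M ! b"
      using ab \<open>b < q\<close> by (simp add: M_def)
  qed
  have "(\<Prod>x\<leftarrow>K. y - x) = (\<Prod>x\<leftarrow>M. y - x)" for y
  proof (rule LIMSEQ_unique)
    have "strict_mono (\<lambda>k. r (s k))"
      using strict_mono_o[OF r(1) s(1)] by (simp add: o_def)
    from LIMSEQ_subseq_LIMSEQ[OF lim this]
    show "(\<lambda>k. \<Prod>x\<leftarrow>L (r (s k)). y - x) \<longlonglongrightarrow> (\<Prod>x\<leftarrow>K. y - x)"
      by (simp add: o_def)
    have "(\<lambda>k. \<Prod>j<q. y - L (r (s k)) ! j) \<longlonglongrightarrow> (\<Prod>j<q. y - \<mu> j)"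
      by (intro tendsto_intros \<mu>) auto
    moreover have "(\<Prod>x\<leftarrow>M. y - x) = (\<Prod>j<q. y - M ! j)"
      by (rule prod_nth) (simp add: M_def)
    then have "(\<Prod>x\<leftarrow>M. y - x) = (\<Prod>j<q. y - \<mu> j)"
      by (simp add: M_def)
    ultimately show "(\<lambda>k. \<Prod>x\<leftarrow>L (r (s k)). y - x) \<longlonglongrightarrow> (\<Prod>x\<leftarrow>M. y - x)"
      by (simp add: prod_nth len)
  qed
  \<comment> \<open>Equal polynomial functions have the same multiset of roots, and sortedness
    upgrades this to equality of lists. So the \<open>i\<close>-th root does approach
    \<open>K ! i\<close> along the subsequence.\<close>
  then have "poly (\<Prod>x\<leftarrow>K. [:- x, 1:]) = poly (\<Prod>x\<leftarrow>M. [:- x, 1:])"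
    by (simp add: poly_linear_factors fun_eq_iff)
  then have "(\<Prod>x\<leftarrow>K. [:- x, 1:]) = (\<Prod>x\<leftarrow>M. [:- x, 1:])"
    by (simp add: poly_eq_poly_eq_iff)
  then have "mset K = mset M"
    by (metis proots_linear_factors)
  then have "K = M"
    using sorted(2) \<open>sorted M\<close> by (metis properties_for_sort)
  then have "(\<lambda>k. L (r (s k)) ! i) \<longlonglongrightarrow> K ! i"
    using \<mu>[OF i] i by (simp add: M_def)
  then have "\<forall>\<^sub>F k in sequentially. dist (L (r (s k)) ! i) (K ! i) < e"
    using e(1) by (rule tendstoD)
  then show False
    using r(2) by (auto simp: eventually_sequentially)
qed

text \<open>The whole list is kept because convergence of one ordered eigenvalue is deduced from
  that of all roots together.\<close>

definition floquet_eigenvalues ::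
  "('d::finite \<Rightarrow> nat) \<Rightarrow> (('d \<Rightarrow> int) \<Rightarrow> real) \<Rightarrow> ('d \<Rightarrow> real) \<Rightarrow> real list" where
  "floquet_eigenvalues p V \<theta> =
     sorted_list_of_multiset (image_mset Re (proots (char_poly (floquet_matrix p V \<theta>))))"

lemma char_poly_floquet_matrix_nonzero: "char_poly (floquet_matrix p V \<theta>) \<noteq> 0"
  using degree_monic_char_poly[OF floquet_matrix_carrier[where p = p and V = V and \<theta> = \<theta>]] by auto

lemma length_floquet_eigenvalues: "length (floquet_eigenvalues p V \<theta>) = cell_size p"
proof -
  have "length (floquet_eigenvalues p V \<theta>) = size (proots (char_poly (floquet_matrix p V \<theta>)))"
    unfolding floquet_eigenvalues_def by (metis mset_sorted_list_of_multiset size_image_mset size_mset)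
  then show ?thesis
    using degree_monic_char_poly[OF floquet_matrix_carrier[where p = p and V = V and \<theta> = \<theta>]] by (simp add: size_proots_complex)
qed

lemma floquet_eigenvalue_nth: "floquet_eigenvalue p V i \<theta> = floquet_eigenvalues p V \<theta> ! i"
  by (simp add: floquet_eigenvalue_def floquet_eigenvalues_def)

lemma set_floquet_eigenvalues:
  "set (floquet_eigenvalues p V \<theta>) = Re ` {z. poly (char_poly (floquet_matrix p V \<theta>)) z = 0}"
  by (simp add: floquet_eigenvalues_def set_count_proots[OF char_poly_floquet_matrix_nonzero])

lemma zero_in_quasimomenta: "(\<lambda>j. 0) \<in> quasimomenta"
  by (simp add: quasimomenta_def)

section \<open>The bands of one periodic operator\<close>

context
  fixes V :: "('d::finite \<Rightarrow> int) \<Rightarrow> real" and p :: "'d \<Rightarrow> nat"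
  assumes T: "bounded_op (schrodinger V)" "selfadjoint_op (schrodinger V)"
    and V: "periodic_potential p V"
begin

lemma period_pos: "\<forall>j. 0 < p j"
  using V by (simp add: periodic_potential_def)

text \<open>The eigenvector extends to a Bloch solution, so that reality and membership in the
  spectrum both come from the self-adjoint operator on the lattice.\<close>

lemma char_poly_floquet_matrix_root:
  assumes "poly (char_poly (floquet_matrix p V \<theta>)) z = 0"
  shows "z = of_real (Re z)" "Re z \<in> spec (schrodinger V)"
proof -
  have "eigenvalue (floquet_matrix p V \<theta>) z"
    using assms eigenvalue_root_char_poly[OF floquet_matrix_carrier] by blast
  then obtain v where v: "v \<in> floquet_space p \<theta>" "v \<noteq> (\<lambda>n. 0)" "\<And>n. schrodinger V v n = z * v n"
    unfolding floquet_matrix_eigenvalue_iff[OF V] by blast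
  from bloch_solution_in_spec[OF T period_pos v]
  show "z = of_real (Re z)" "Re z \<in> spec (schrodinger V)"
    by (simp_all add: complex_eq_iff)
qed

lemma set_floquet_eigenvalues_subset: "set (floquet_eigenvalues p V \<theta>) \<subseteq> spec (schrodinger V)"
  unfolding set_floquet_eigenvalues using char_poly_floquet_matrix_root by auto

text \<open>Since the roots are real, taking real parts loses nothing. This brings convergence of
  the characteristic polynomials into the form that \<open>sorted_roots_tendsto\<close>
  expects.\<close>

lemma poly_char_poly_floquet_matrix:
  "poly (char_poly (floquet_matrix p V \<theta>)) (of_real y) = of_real (\<Prod>x\<leftarrow>floquet_eigenvalues p V \<theta>. y - x)"
proof -
  let ?P = "char_poly (floquet_matrix p V \<theta>)"
  obtain as where as: "?P = (\<Prod>a\<leftarrow>as. [:- a, 1:])"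
    using char_poly_factorized[OF floquet_matrix_carrier] by blast
  have mas: "mset as = proots ?P" unfolding as by (simp add: proots_linear_factors)
  have real: "a = of_real (Re a)" if "a \<in># mset as" for a
    using that char_poly_floquet_matrix_root(1)[where \<theta> = \<theta>]
    unfolding mas set_count_proots[OF char_poly_floquet_matrix_nonzero] by blast
  have "poly ?P (of_real y) = prod_mset (image_mset (\<lambda>a. of_real y - a) (mset as))"
    unfolding as poly_linear_factors by (simp flip: prod_mset_prod_list)
  also have "image_mset (\<lambda>a. of_real y - a) (mset as) = image_mset (\<lambda>a. of_real (y - Re a)) (mset as)"
    using real by (intro image_mset_cong) (metis of_real_diff)
  also have "prod_mset \<dots> = complex_of_real (prod_mset (image_mset (\<lambda>a. y - Re a) (mset as)))"
    by (simp add: of_real_prod_mset)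
  also have "image_mset (\<lambda>a. y - Re a) (mset as) = mset (map (\<lambda>x. y - x) (floquet_eigenvalues p V \<theta>))"
    unfolding mas floquet_eigenvalues_def by (simp add: multiset.map_comp o_def)
  finally show ?thesis by (simp only: prod_mset_prod_list)
qed

lemma floquet_eigenvalue_in_spec:
  "i < cell_size p \<Longrightarrow> floquet_eigenvalue p V i \<theta> \<in> spec (schrodinger V)"
  unfolding floquet_eigenvalue_nth
  using set_floquet_eigenvalues_subset[of \<theta>] length_floquet_eigenvalues[where \<theta> = \<theta>] by (metis nth_mem subsetD)

lemma floquet_eigenvalue_tendsto:
  assumes \<Theta>: "\<And>j. (\<lambda>k. \<Theta> k j) \<longlonglongrightarrow> \<theta> j" and i: "i < cell_size p"
  shows "(\<lambda>k. floquet_eigenvalue p V i (\<Theta> k)) \<longlonglongrightarrow> floquet_eigenvalue p V i \<theta>"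
proof -
  \<comment> \<open>All Floquet eigenvalues lie in one compact set, which bounds the roots uniformly
    in the quasimomentum.\<close>
  have "bounded (spec (schrodinger V))"
    using compact_spec[OF T] by (rule compact_imp_bounded)
  then obtain B where B: "\<And>x. x \<in> spec (schrodinger V) \<Longrightarrow> \<bar>x\<bar> \<le> B"
    unfolding bounded_iff by auto
  show ?thesis
    unfolding floquet_eigenvalue_nth
  proof (rule sorted_roots_tendsto[OF length_floquet_eigenvalues length_floquet_eigenvalues])
    show "(\<lambda>k. \<Prod>x\<leftarrow>floquet_eigenvalues p V (\<Theta> k). y - x) \<longlonglongrightarrow> (\<Prod>x\<leftarrow>floquet_eigenvalues p V \<theta>. y - x)" for y
      using tendsto_Re[OF tendsto_char_poly_floquet_matrix[OF period_pos \<Theta>, where V = V and z = "of_real y"]]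
      unfolding poly_char_poly_floquet_matrix by simp
    show "\<bar>x\<bar> \<le> B" if "x \<in> set (floquet_eigenvalues p V (\<Theta> k))" for k x
      using that set_floquet_eigenvalues_subset B by blast
  qed (use i in \<open>simp_all add: floquet_eigenvalues_def\<close>)
qed

lemma floquet_eigenvalue_in_band:
  assumes i: "i < cell_size p" and \<theta>: "\<theta> \<in> quasimomenta"
  shows "band_lower p V i \<le> floquet_eigenvalue p V i \<theta>" "floquet_eigenvalue p V i \<theta> \<le> band_upper p V i"
proof -
  have "floquet_eigenvalue p V i ` quasimomenta \<subseteq> spec (schrodinger V)"
    using floquet_eigenvalue_in_spec[OF i] by auto
  then have "bounded (floquet_eigenvalue p V i ` quasimomenta)"
    using compact_imp_bounded[OF compact_spec[OF T]] bounded_subset by blast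
  then have "bdd_below (floquet_eigenvalue p V i ` quasimomenta)" "bdd_above (floquet_eigenvalue p V i ` quasimomenta)"
    by (rule bounded_imp_bdd_below, rule bounded_imp_bdd_above)
  then show "band_lower p V i \<le> floquet_eigenvalue p V i \<theta>" "floquet_eigenvalue p V i \<theta> \<le> band_upper p V i"
    unfolding band_lower_def band_upper_def using \<theta> by (auto intro: cINF_lower cSUP_upper)
qed

lemma band_lower_le_upper: "i < cell_size p \<Longrightarrow> band_lower p V i \<le> band_upper p V i"
  using floquet_eigenvalue_in_band[OF _ zero_in_quasimomenta] by (meson order_trans)

text \<open>Strictly between the infimum and the supremum there are eigenvalues on both sides of
  \<open>x\<close>. By the intermediate value theorem on the segment joining their quasimomenta,
  \<open>x\<close> is an eigenvalue as well.\<close>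

lemma band_interior_subset_spec:
  assumes i: "i < cell_size p" and x: "band_lower p V i < x" "x < band_upper p V i"
  shows "x \<in> spec (schrodinger V)"
proof -
  have ne: "(quasimomenta :: ('d \<Rightarrow> real) set) \<noteq> {}"
    using zero_in_quasimomenta by blast
  obtain \<theta>0 where \<theta>0: "\<theta>0 \<in> quasimomenta" "floquet_eigenvalue p V i \<theta>0 < x"
    using cInf_lessD[OF _ x(1)[unfolded band_lower_def]] ne by blast
  obtain \<theta>1 where \<theta>1: "\<theta>1 \<in> quasimomenta" "x < floquet_eigenvalue p V i \<theta>1"
    using less_cSupD[OF _ x(2)[unfolded band_upper_def]] ne by blast
  define f where "f t = floquet_eigenvalue p V i (\<lambda>j. (1 - t) * \<theta>0 j + t * \<theta>1 j)" for t
  have "continuous_on {0..1} f"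
    unfolding continuous_on_sequentially
  proof (intro ballI allI impI)
    fix X :: "nat \<Rightarrow> real" and a assume "a \<in> {0..1}" "(\<forall>n. X n \<in> {0..1}) \<and> X \<longlonglongrightarrow> a"
    then have X: "X \<longlonglongrightarrow> a" by simp
    show "(f \<circ> X) \<longlonglongrightarrow> f a"
      unfolding f_def o_def by (intro floquet_eigenvalue_tendsto i tendsto_intros X)
  qed
  moreover have "f 0 \<le> x" "x \<le> f 1"
    using \<theta>0 \<theta>1 by (simp_all add: f_def)
  ultimately obtain t where "f t = x"
    using IVT'[of f 0 x 1] by auto
  then show ?thesis
    using floquet_eigenvalue_in_spec[OF i] unfolding f_def by metis
qed

text \<open>The end points follow from closedness of the spectrum. A band that degenerates to a
  point has empty interior and is covered by the eigenvalue at quasimomentum 0.\<close>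

lemma band_subset_spec:
  assumes i: "i < cell_size p"
  shows "{band_lower p V i..band_upper p V i} \<subseteq> spec (schrodinger V)"
proof (cases "band_lower p V i < band_upper p V i")
  case True
  have "closed (spec (schrodinger V))"
    using compact_spec[OF T] by (rule compact_imp_closed)
  moreover have "{band_lower p V i<..<band_upper p V i} \<subseteq> spec (schrodinger V)"
    using band_interior_subset_spec[OF i] by auto
  ultimately have "closure {band_lower p V i<..<band_upper p V i} \<subseteq> spec (schrodinger V)"
    by (rule closure_minimal[rotated])
  then show ?thesis using True by simp
next
  case False
  show ?thesis
  proof
    fix x assume "x \<in> {band_lower p V i..band_upper p V i}"
    with False floquet_eigenvalue_in_band[OF i zero_in_quasimomenta]
    have "x = floquet_eigenvalue p V i (\<lambda>j. 0)" by auto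
    then show "x \<in> spec (schrodinger V)"
      using floquet_eigenvalue_in_spec[OF i] by simp
  qed
qed

theorem spec_eq_bands: "spec (schrodinger V) = (\<Union>i<cell_size p. {band_lower p V i..band_upper p V i})"
proof
  show "(\<Union>i<cell_size p. {band_lower p V i..band_upper p V i}) \<subseteq> spec (schrodinger V)"
    using band_subset_spec by blast
  show "spec (schrodinger V) \<subseteq> (\<Union>i<cell_size p. {band_lower p V i..band_upper p V i})"
  proof
    fix x assume "x \<in> spec (schrodinger V)"
    from spec_imp_bloch_solution[OF T V this] obtain \<theta> where \<theta>: "\<theta> \<in> quasimomenta"
      and "eigenvalue (floquet_matrix p V \<theta>) (of_real x)"
      unfolding floquet_matrix_eigenvalue_iff[OF V] by blast
    then have "poly (char_poly (floquet_matrix p V \<theta>)) (of_real x) = 0"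
      using eigenvalue_root_char_poly[OF floquet_matrix_carrier] by blast
    then have "x \<in> set (floquet_eigenvalues p V \<theta>)"
      unfolding set_floquet_eigenvalues by (auto intro!: image_eqI[of _ _ "of_real x"])
    then obtain i where i: "i < cell_size p" "x = floquet_eigenvalue p V i \<theta>"
      unfolding floquet_eigenvalue_nth by (metis in_set_conv_nth length_floquet_eigenvalues)
    with floquet_eigenvalue_in_band[OF i(1) \<theta>]
    show "x \<in> (\<Union>i<cell_size p. {band_lower p V i..band_upper p V i})" by auto
  qed
qed

end

section \<open>Convergence of the measures\<close>

lemma locally_finite_borel_compact:
  assumes \<mu>: "locally_finite_borel \<mu>" and K: "compact K"
  shows "emeasure \<mu> K < \<infinity>"
proof -
  have sets: "sets \<mu> = sets borel" using \<mu> by (simp add: locally_finite_borel_def)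
  have "\<forall>x. \<exists>U. open U \<and> x \<in> U \<and> emeasure \<mu> U < \<infinity>"
    using \<mu> by (simp add: locally_finite_borel_def)
  then obtain U where U: "\<And>x. open (U x)" "\<And>x. x \<in> U x" "\<And>x. emeasure \<mu> (U x) < \<infinity>"
    by metis
  obtain C where C: "C \<subseteq> K" "finite C" "K \<subseteq> (\<Union>x\<in>C. U x)"
    by (rule compactE_image[OF K, of K U]) (use U in blast)+
  have "emeasure \<mu> K \<le> emeasure \<mu> (\<Union>x\<in>C. U x)"
    using C U(1) by (intro emeasure_mono) (auto simp: sets)
  also have "\<dots> \<le> (\<Sum>x\<in>C. emeasure \<mu> (U x))"
    using C U(1) by (intro emeasure_subadditive_finite) (auto simp: sets)
  also have "\<dots> < \<infinity>"
    using C(2) U(3) by (simp add: less_top[symmetric])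
  finally show ?thesis .
qed

text \<open>Compactness makes the suprema in the definition bounded, so that they dominate the
  individual distances.\<close>

lemma infdist_le_hausdorff:
  assumes AB: "compact A" "compact B" "A \<noteq> {}" "B \<noteq> {}"
  shows "a \<in> A \<Longrightarrow> infdist a B \<le> hausdorff_distance A B"
    and "b \<in> B \<Longrightarrow> infdist b A \<le> hausdorff_distance A B"
proof -
  have bdd: "bdd_above ((\<lambda>x. infdist x D) ` C)" if "compact C" for C D :: "real set"
    by (intro bounded_imp_bdd_above compact_imp_bounded compact_continuous_image continuous_intros that)
  show "infdist a B \<le> hausdorff_distance A B" if "a \<in> A"
    unfolding hausdorff_distance_def by (intro max.coboundedI1 cSUP_upper that bdd AB)
  show "infdist b A \<le> hausdorff_distance A B" if "b \<in> B"
    unfolding hausdorff_distance_def by (intro max.coboundedI2 cSUP_upper that bdd AB)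
qed

text \<open>Continuity from above: the neighbourhoods decrease to \<open>S\<close> because
  \<open>S\<close> is closed, and they have finite measure because they are compact and the measure
  is locally finite.\<close>

lemma emeasure_neighbourhoods_tendsto:
  assumes \<mu>: "locally_finite_borel \<mu>" and S: "compact S" "S \<noteq> {}"
  shows "(\<lambda>m. emeasure \<mu> {x. infdist x S \<le> inverse (real (Suc m))}) \<longlonglongrightarrow> emeasure \<mu> S"
proof -
  let ?A = "\<lambda>m. {x. infdist x S \<le> inverse (real (Suc m))}"
  have A: "compact (?A m)" for m
    using S by (intro compact_infdist_le) auto
  have "(\<Inter>m. ?A m) = S"
  proof (intro equalityI subsetI)
    fix x assume "x \<in> (\<Inter>m. ?A m)"
    then have "infdist x S \<le> 0"
      by (intro LIMSEQ_le_const[OF LIMSEQ_inverse_real_of_nat]) auto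
    then have "infdist x S = 0"
      using infdist_nonneg[of x S] by simp
    then show "x \<in> S"
      using in_closed_iff_infdist_zero[OF compact_imp_closed[OF S(1)] S(2)] by blast
  qed simp
  moreover have "(\<lambda>m. emeasure \<mu> (?A m)) \<longlonglongrightarrow> emeasure \<mu> (\<Inter>m. ?A m)"
  proof (rule Lim_emeasure_decseq)
    show "range ?A \<subseteq> sets \<mu>"
      using \<mu> A by (auto simp: locally_finite_borel_def compact_imp_closed)
    have "inverse (real (Suc n)) \<le> inverse (real (Suc m))" if "m \<le> n" for m n
      using that by (intro le_imp_inverse_le) auto
    then show "decseq ?A"
      unfolding decseq_def by (auto intro: order_trans)
    show "emeasure \<mu> (?A m) \<noteq> \<infinity>" for m
      using locally_finite_borel_compact[OF \<mu> A[of m]] by auto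
  qed
  ultimately show ?thesis by simp
qed

theorem corollary1p2:
  fixes V :: "('d::finite \<Rightarrow> int) \<Rightarrow> real"
    and W :: "nat \<Rightarrow> ('d \<Rightarrow> int) \<Rightarrow> real"
    and p :: "nat \<Rightarrow> 'd \<Rightarrow> nat"
    and \<mu> :: "real measure"
    and \<delta> :: "nat \<Rightarrow> real"
  assumes "bounded_op (schrodinger V)" and "selfadjoint_op (schrodinger V)"
    and "locally_finite_borel \<mu>"
    and "\<And>n. bounded_op (schrodinger (W n))" and "\<And>n. selfadjoint_op (schrodinger (W n))"
    and "\<And>n. periodic_potential (p n) (W n)"
    and "\<And>n. \<delta> n = hausdorff_distance (spec (schrodinger (W n))) (spec (schrodinger V))"
    and "\<delta> \<longlonglongrightarrow> 0"
  shows "(\<lambda>n. emeasure \<mu> (\<Union>i<cell_size (p n).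
            {band_lower (p n) (W n) i - \<delta> n .. band_upper (p n) (W n) i + \<delta> n}))
         \<longlonglongrightarrow> emeasure \<mu> (spec (schrodinger V))"
proof -
  define S where "S = spec (schrodinger V)"
  define R where "R n = spec (schrodinger (W n))" for n
  define a where "a n i = band_lower (p n) (W n) i" for n i
  define b where "b n i = band_upper (p n) (W n) i" for n i
  define U where "U n = (\<Union>i<cell_size (p n). {a n i - \<delta> n..b n i + \<delta> n})" for n
  have sets: "sets \<mu> = sets borel"
    using assms(3) by (simp add: locally_finite_borel_def)
  have S: "compact S" "S \<noteq> {}"
    unfolding S_def using compact_spec spec_nonempty assms(1,2) by blast+
  have R: "compact (R n)" "R n \<noteq> {}" for n
    unfolding R_def using compact_spec spec_nonempty assms(4,5) by blast+
  have bands: "R n = (\<Union>i<cell_size (p n). {a n i..b n i})" for n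
    unfolding R_def a_def b_def by (rule spec_eq_bands[OF assms(4,5,6)])
  have ab: "a n i \<le> b n i" if "i < cell_size (p n)" for n i
    unfolding a_def b_def by (rule band_lower_le_upper[OF assms(4,5,6) that])
  have d: "\<delta> n = hausdorff_distance (R n) S" for n
    unfolding R_def S_def by (rule assms(7))
  have dR: "infdist x S \<le> \<delta> n" if "x \<in> R n" for x n
    unfolding d by (rule infdist_le_hausdorff(1)[OF R(1) S(1) R(2) S(2) that])
  have dS: "infdist x (R n) \<le> \<delta> n" if "x \<in> S" for x n
    unfolding d by (rule infdist_le_hausdorff(2)[OF R(1) S(1) R(2) S(2) that])
  have d0: "0 \<le> \<delta> n" for n
    using R(2)[of n] dR infdist_nonneg order_trans by (metis ex_in_conv)
  \<comment> \<open>The distance to the compact set \<open>R n\<close> is attained at a point of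
    some band, and it is at most \<open>\<delta> n\<close>; the enlargement of that band therefore
    reaches \<open>x\<close>.\<close>
  have SU: "S \<subseteq> U n" for n
  proof
    fix x assume "x \<in> S"
    obtain y where y: "y \<in> R n" "infdist x (R n) = dist x y"
      using infdist_attains_inf[OF compact_imp_closed[OF R(1)] R(2)] by blast
    obtain i where "i < cell_size (p n)" "y \<in> {a n i..b n i}"
      using y(1) unfolding bands by blast
    moreover have "\<bar>x - y\<bar> \<le> \<delta> n"
      using dS[OF \<open>x \<in> S\<close>, of n] y(2) by (simp add: dist_real_def)
    ultimately have "x \<in> {a n i - \<delta> n..b n i + \<delta> n}" by auto
    with \<open>i < cell_size (p n)\<close> show "x \<in> U n" unfolding U_def by blast
  qed
  have U_near: "infdist x S \<le> 2 * \<delta> n" if x: "x \<in> U n" for x n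
  proof -
    obtain i where i: "i < cell_size (p n)" "x \<in> {a n i - \<delta> n..b n i + \<delta> n}"
      using x unfolding U_def by blast
    \<comment> \<open>\<open>y\<close> is the point of the original band nearest to
      \<open>x\<close>. One \<open>\<delta> n\<close> is spent from \<open>x\<close> to
      \<open>y\<close> and another from \<open>y\<close> to \<open>S\<close>.\<close>
    define y where "y = max (a n i) (min x (b n i))"
    have "y \<in> {a n i..b n i}" using ab[OF i(1)] by (auto simp: y_def)
    then have "y \<in> R n" unfolding bands using i(1) by blast
    moreover have "dist x y \<le> \<delta> n"
      using i(2) ab[OF i(1)] d0[of n] by (auto simp: y_def dist_real_def max_def min_def)
    ultimately show ?thesis
      using infdist_triangle[of x S y] dR[of y n] by linarith
  qed
  have "(\<lambda>n. emeasure \<mu> (U n)) \<longlonglongrightarrow> emeasure \<mu> S"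
  proof (rule order_tendstoI)
    \<comment> \<open>The lower half needs no limit, since \<open>S\<close> is contained in every
      \<open>U n\<close>.\<close>
    fix c assume "c < emeasure \<mu> S"
    moreover have "emeasure \<mu> S \<le> emeasure \<mu> (U n)" for n
      by (rule emeasure_mono[OF SU]) (simp add: sets U_def)
    ultimately show "\<forall>\<^sub>F n in sequentially. c < emeasure \<mu> (U n)"
      by (intro always_eventually allI) (rule order_less_le_trans)
  next
    fix c assume "emeasure \<mu> S < c"
    then have "\<forall>\<^sub>F m in sequentially. emeasure \<mu> {x. infdist x S \<le> inverse (real (Suc m))} < c"
      using emeasure_neighbourhoods_tendsto[OF assms(3) S] by (rule order_tendstoD(2)[rotated])
    then obtain m where m: "emeasure \<mu> {x. infdist x S \<le> inverse (real (Suc m))} < c"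
      by (auto simp: eventually_sequentially)
    have "compact {x. infdist x S \<le> inverse (real (Suc m))}"
      using S by (intro compact_infdist_le) auto
    then have meas: "{x. infdist x S \<le> inverse (real (Suc m))} \<in> sets \<mu>"
      by (simp add: sets compact_imp_closed)
    \<comment> \<open>Half the radius, because \<open>U n\<close> may extend to distance
      \<open>2 * \<delta> n\<close> from \<open>S\<close>.\<close>
    have "\<forall>\<^sub>F n in sequentially. \<delta> n < inverse (real (Suc m)) / 2"
      by (rule order_tendstoD(2)[OF assms(8)]) simp
    then show "\<forall>\<^sub>F n in sequentially. emeasure \<mu> (U n) < c"
    proof eventually_elim
      case (elim n)
      then have "U n \<subseteq> {x. infdist x S \<le> inverse (real (Suc m))}"
        using U_near[of _ n] by fastforce
      from order_le_less_trans[OF emeasure_mono[OF this meas] m] show ?case .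
    qed
  qed
  then show ?thesis
    unfolding U_def a_def b_def S_def .
qed

end
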